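(* Let $G$ be a triangulated ring with cyclic parity sequence $\mathrm{cps}(G)$. Then $G$ is $3$-colorable if and only if $\mathrm{cps}(G)\in T$.
   Context: A triangulated ring is a $2$-connected plane graph $G$ with minimum degree $\ge 3$ having two distinguished faces $F_i$ (inner) and $F_o$ (outer) whose facial walks are induced cycles $C_i$ and $C_o$, respectively, such that (1) $V(C_i)\cup V(C_o)=V(G)$ and $V(C_i)\cap V(C_o)=\emptyset$; (2) every face other than $F_i$ and $F_o$ is a triangle. Fans: each triangular face has one edge on one of the two cycles $C_i,C_o$ and its opposite vertex (its apex) on the other cycle. Going once around the ring, the triangular faces occur in a cyclic order in which consecutive triangles share an edge joining $C_i$ to $C_o$. The fans $F_0,F_1,\dots,F_{2k-1}$ of $G$ (in cyclic order) are the maximal runs of consecutive triangles in this order having a common apex; they partition the triangular faces. The common apex of $F_j$, which is the vertex of the fan adjacent to all its other vertices, is denoted $f_j$. The apexes lie alternately on $C_i$ and $C_o$, the fan $F_j$ contains $f_{j-1},f_j,f_{j+1}$ (indices modulo $2k$), and $f_0,f_1,\dots,f_{2k-1}$ is an even closed cycle (the fan graph). The cyclic parity sequence $\mathrm{cps}(G)$ is the cyclic sequence $p_0p_1\cdots p_{2k-1}$, where $p_j\in\{e,o\}$ is the parity ($e$ = even, $o$ = odd) of the number of triangles in $F_j$. $e$-collapse: if $p_0p_1\cdots p_{2k-1}$ is a cyclic parity sequence with $k\ge 2$ and $p_j=e$, its $e$-collapse at $j$ is the cyclic sequence of length $2k-2$ given by $p_0p_1\cdots p_{j-2}(p_{j-1}+p_{j+1})p_{j+2}\cdots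 p_{2k-1}$ (indices cyclic modulo $2k$), where addition is addition of parities modulo $2$ ($e+e=o+o=e$, $e+o=o+e=o$). $T$ is the set of all cyclic parity sequences that can be transformed, by a finite number (possibly zero) of $e$-collapses, into $ee$ or into $(o)^{6m}$, the cyclic sequence consisting of $6m$ letters $o$, for some positive integer $m$. A graph is $3$-colorable if it has a proper vertex coloring with $3$ colors. *)

theory Defs
  imports "HOL-Analysis.Analysis" "HOL-Library.Z2"
begin

section \<open>Plane graphs\<close>

text \<open>Vertices are points of the plane, an edge is the set of its two ends, and
  \<open>drawing G e\<close> is a parametrisation of the arc representing the edge \<open>e\<close>.
  Graphs are simple by construction.\<close>

record drawn_graph =
  verts :: "complex set"
  edges :: "complex set set"
  drawing :: "complex set \<Rightarrow> real \<Rightarrow> complex"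

abbreviation edge_arc :: "'a drawn_graph_scheme \<Rightarrow> complex set \<Rightarrow> complex set" where
  "edge_arc G e \<equiv> path_image (drawing G e)"

definition plane_graph :: "'a drawn_graph_scheme \<Rightarrow> bool" where
  "plane_graph G \<longleftrightarrow>
     finite (verts G) \<and>
     (\<forall>e\<in>edges G.
        e \<subseteq> verts G \<and>
        arc (drawing G e) \<and>
        {pathstart (drawing G e), pathfinish (drawing G e)} = e \<and>
        edge_arc G e \<inter> verts G = e) \<and>
     (\<forall>e\<in>edges G. \<forall>e'\<in>edges G. e \<noteq> e' \<longrightarrow> edge_arc G e \<inter> edge_arc G e' = e \<inter> e')"

definition point_set :: "'a drawn_graph_scheme \<Rightarrow> complex set" where
  "point_set G = verts G \<union> (\<Union>e\<in>edges G. edge_arc G e)"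

definition faces :: "'a drawn_graph_scheme \<Rightarrow> complex set set" where
  "faces G = components (- point_set G)"

definition degree :: "'a drawn_graph_scheme \<Rightarrow> complex \<Rightarrow> nat" where
  "degree G v = card {e \<in> edges G. v \<in> e}"

definition induces_connected :: "'a drawn_graph_scheme \<Rightarrow> complex set \<Rightarrow> bool" where
  "induces_connected G S \<longleftrightarrow>
     (\<forall>u\<in>S. \<forall>v\<in>S. (u, v) \<in> {(x, y). x \<in> S \<and> y \<in> S \<and> {x, y} \<in> edges G}\<^sup>*)"

definition two_connected :: "'a drawn_graph_scheme \<Rightarrow> bool" where
  "two_connected G \<longleftrightarrow>
     card (verts G) > 2 \<and>
     (\<forall>X\<subseteq>verts G. card X < 2 \<longrightarrow> induces_connected G (verts G - X))"

definition three_colorable :: "'a drawn_graph_scheme \<Rightarrow> bool" where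
  "three_colorable G \<longleftrightarrow>
     (\<exists>col :: complex \<Rightarrow> nat. (\<forall>v\<in>verts G. col v < 3) \<and>
        (\<forall>u v. {u, v} \<in> edges G \<longrightarrow> col u \<noteq> col v))"

text \<open>A cycle is given by the list of its vertices in cyclic order.\<close>

definition cycle_edges :: "complex list \<Rightarrow> complex set set" where
  "cycle_edges c = {{c ! i, c ! (Suc i mod length c)} | i. i < length c}"

definition is_cycle :: "'a drawn_graph_scheme \<Rightarrow> complex list \<Rightarrow> bool" where
  "is_cycle G c \<longleftrightarrow>
     length c \<ge> 3 \<and> distinct c \<and> set c \<subseteq> verts G \<and> cycle_edges c \<subseteq> edges G"

definition induced_cycle :: "'a drawn_graph_scheme \<Rightarrow> complex list \<Rightarrow> bool" where
  "induced_cycle G c \<longleftrightarrow>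
     is_cycle G c \<and> (\<forall>e\<in>edges G. e \<subseteq> set c \<longrightarrow> e \<in> cycle_edges c)"

text \<open>In a 2-connected plane graph the facial walk of a face is the cycle whose drawing is
  the topological boundary of the face.\<close>

definition facial_cycle :: "'a drawn_graph_scheme \<Rightarrow> complex set \<Rightarrow> complex list \<Rightarrow> bool" where
  "facial_cycle G F c \<longleftrightarrow>
     is_cycle G c \<and> frontier F = (\<Union>e\<in>cycle_edges c. edge_arc G e)"

definition face_verts :: "'a drawn_graph_scheme \<Rightarrow> complex set \<Rightarrow> complex set" where
  "face_verts G F = {v \<in> verts G. v \<in> frontier F}"

definition face_edges :: "'a drawn_graph_scheme \<Rightarrow> complex set \<Rightarrow> complex set set" where
  "face_edges G F = {e \<in> edges G. edge_arc G e \<subseteq> frontier F}"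

section \<open>Triangulated rings\<close>

text \<open>\<open>Inner\<close> and \<open>outer\<close> only name the two distinguished faces; neither of them is
  required to be the unbounded one.\<close>

record ring_graph = drawn_graph +
  inner_face :: "complex set"
  outer_face :: "complex set"
  inner_cycle :: "complex list"
  outer_cycle :: "complex list"

definition triangulated_ring :: "ring_graph \<Rightarrow> bool" where
  "triangulated_ring G \<longleftrightarrow>
     plane_graph G \<and> two_connected G \<and> (\<forall>v\<in>verts G. degree G v \<ge> 3) \<and>
     inner_face G \<in> faces G \<and> outer_face G \<in> faces G \<and> inner_face G \<noteq> outer_face G \<and>
     facial_cycle G (inner_face G) (inner_cycle G) \<and> induced_cycle G (inner_cycle G) \<and>
     facial_cycle G (outer_face G) (outer_cycle G) \<and> induced_cycle G (outer_cycle G) \<and>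
     set (inner_cycle G) \<union> set (outer_cycle G) = verts G \<and>
     set (inner_cycle G) \<inter> set (outer_cycle G) = {} \<and>
     (\<forall>F \<in> faces G - {inner_face G, outer_face G}. \<exists>c. facial_cycle G F c \<and> length c = 3)"

definition triangles :: "ring_graph \<Rightarrow> complex set set" where
  "triangles G = faces G - {inner_face G, outer_face G}"

definition apex :: "ring_graph \<Rightarrow> complex set \<Rightarrow> complex" where
  "apex G F = (THE x. x \<in> face_verts G F \<and>
     (\<exists>e \<in> face_edges G F.
        x \<in> set (outer_cycle G) \<and> e \<in> cycle_edges (inner_cycle G) \<or>
        x \<in> set (inner_cycle G) \<and> e \<in> cycle_edges (outer_cycle G)))"

definition cross_edges :: "ring_graph \<Rightarrow> complex set set" where
  "cross_edges G =
     {e \<in> edges G. \<exists>x \<in> set (inner_cycle G). \<exists>y \<in> set (outer_cycle G). e = {x, y}}"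

text \<open>The triangular faces, each listed once, going once around the ring.\<close>

definition ring_order :: "ring_graph \<Rightarrow> complex set list \<Rightarrow> bool" where
  "ring_order G ts \<longleftrightarrow>
     distinct ts \<and> set ts = triangles G \<and>
     (\<forall>i < length ts. \<exists>e \<in> cross_edges G.
        e \<in> face_edges G (ts ! i) \<and> e \<in> face_edges G (ts ! (Suc i mod length ts)))"

text \<open>The fans in cyclic order, each fan being the list of its triangles. A run is maximal
  since the apex changes from each run to the next. The triangles are listed from the
  start of a fan, so that no run is cut by the beginning of the list.\<close>

definition fans :: "ring_graph \<Rightarrow> complex set list list \<Rightarrow> bool" where
  "fans G fs \<longleftrightarrow>
     ring_order G (concat fs) \<and>
     (\<forall>f \<in> set fs. f \<noteq> [] \<and> (\<forall>F \<in> set f. apex G F = apex G (hd f))) \<and>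
     (\<forall>j < length fs. apex G (hd (fs ! j)) \<noteq> apex G (hd (fs ! (Suc j mod length fs))))"

section \<open>Cyclic parity sequences\<close>

text \<open>Parities are elements of the two-element field \<open>bit\<close>, where \<open>0\<close> stands for even,
  \<open>1\<close> for odd, and \<open>of_nat n\<close> is the parity of \<open>n\<close>. A cyclic sequence is represented by a
  list of its letters beginning at an arbitrary position, with indices taken modulo the
  length.\<close>

type_synonym parity_seq = "bit list"

text \<open>The fans of a ring determine the list of their parities only up to the choice of the
  starting fan and of the direction of traversal. The set \<open>T\<close> below does not depend on
  either choice, so any of these lists can represent the cyclic parity sequence.\<close>

definition cps :: "ring_graph \<Rightarrow> parity_seq" where
  "cps G = (SOME p. \<exists>fs. fans G fs \<and> p = map (\<lambda>f. of_nat (length f)) fs)"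

text \<open>The e-collapse at \<open>j\<close>, written from the merged letter on:
  \<open>(p_(j-1) + p_(j+1)) p_(j+2) ... p_(j-2)\<close>.\<close>

definition e_collapse :: "parity_seq \<Rightarrow> nat \<Rightarrow> parity_seq" where
  "e_collapse p j =
     (let n = length p; q = (\<lambda>i. p ! (i mod n))
      in (q (j + n - 1) + q (j + 1)) # map (\<lambda>i. q (j + i)) [2..<n - 1])"

definition collapses_to :: "parity_seq \<Rightarrow> parity_seq \<Rightarrow> bool" where
  "collapses_to p q \<longleftrightarrow>
     even (length p) \<and> length p \<ge> 4 \<and> (\<exists>j < length p. p ! j = 0 \<and> q = e_collapse p j)"

definition T :: "parity_seq set" where
  "T = {p. \<exists>q. collapses_to\<^sup>*\<^sup>* p q \<and>
              (q = [0, 0] \<or> (\<exists>m>0. q = replicate (6 * m) 1))}"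

end

theory Submission
  imports Defs
begin

text \<open>The proof has a topological part, which turns the plane drawing into a purely
  combinatorial ring of triangles, and a combinatorial part, which computes the monodromy of
  3-colourings around that ring.

  The face hypotheses make the topology short: every face of a triangulated ring is bounded by a
  cycle, that is, by a Jordan curve. Near an inner point of an edge the drawing is just that edge,
  so every face reaching that point has the edge on its boundary, and the Jordan curve theorem
  applied to one such face produces a second one. A third one is impossible: by Janiszewski's
  theorem, two further faces on the far side of the Jordan curve of the first, which merge once
  the edge is removed, would already coincide. Hence every edge lies on exactly two faces
  (\<open>edge_on_exactly_two_faces\<close>). Consequently a cycle edge lies on exactly one triangle and a
  cross edge on exactly two; and no triangle can have all its vertices on one of the two cycles,
  for then its boundary would lie on a facial Jordan curve, and this curve would carry the whole
  graph. So each
  triangle has two cross edges, and the dual graph on triangles and cross edges is 2-regular. It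
  is connected (\<open>dual_connected\<close>): in a union of its components, the number of triangles that
  contain a given vertex \<open>a\<close> and have a cycle edge at \<open>a\<close> is even, hence 0 or 2, so that such a
  union propagates along a whole cycle. A finite connected 2-regular structure is a single cycle,
  which gives the cyclic order of the triangles and thereby the existence of the fans.

  Now walk once around the ring and record the colours \<open>(a, b)\<close> of the current cross edge. Crossing
  a triangle replaces one of the two entries by the third colour. A fixed pair of distinct colours
  of the resulting monodromy extends to a colouring of the graph, because the visits of the walk to
  any vertex are contiguous (\<open>visits_contiguous\<close>), so that a vertex is never asked to have two
  colours. Within a fan the same entry changes each time, so only the parity of its length
  matters: in terms of the pair \<open>(u, v)\<close> of colours of two consecutive apexes, an even fan acts by
  \<open>(u, v) \<mapsto> (v, u)\<close> and an odd one by \<open>(u, v) \<mapsto> (v, w)\<close>, where \<open>w\<close> is the third colour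
  (\<open>fan_step\<close>). Around a letter \<open>e\<close> the action of \<open>p e q\<close> is that of the single letter \<open>p + q\<close>, so
  e-collapses do not change whether the monodromy fixes a pair. They end in a sequence of length 2,
  where only \<open>ee\<close> fixes a pair, or in a sequence of letters \<open>o\<close>, whose action has order 3. Since the
  number of fans is even, this characterises \<open>T\<close> (\<open>T_iff_closes_up\<close>).\<close>

section \<open>Cycles of a plane graph as closed curves\<close>

text \<open>The inverse of the arc would inject a plane region continuously into the real line,
  against invariance of dimension.\<close>

lemma interior_arc_image_empty:
  fixes g :: "real \<Rightarrow> complex"
  assumes "arc g"
  shows "interior (path_image g) = {}"
proof (rule ccontr)
  assume ne: "interior (path_image g) \<noteq> {}"
  obtain h where h: "homeomorphism {0..1} (path_image g) g h"
    using homeomorphism_arc[OF assms] by auto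
  have "continuous_on (interior (path_image g)) h"
    using h interior_subset[of "path_image g"]
    by (auto simp: homeomorphism_def intro: continuous_on_subset)
  moreover have "inj_on h (interior (path_image g))"
    using h interior_subset[of "path_image g"]
    by (intro inj_on_inverseI[of _ g]) (auto simp: homeomorphism_def)
  ultimately have "DIM(complex) \<le> DIM(real)"
    by (intro invariance_of_dimension[OF _ open_interior _ ne])
  then show False by simp
qed

text \<open>The edges of the open path along a list; a cycle is such a path together with its closing edge.
  The recursive form supports the construction of the drawn path by joining arcs.\<close>

fun path_edges :: "complex list \<Rightarrow> complex set set" where
  "path_edges (u # v # vs) = insert {u, v} (path_edges (v # vs))"
| "path_edges _ = {}"

lemma path_edges_conv_nth: "path_edges vs = {{vs ! i, vs ! Suc i} | i. Suc i < length vs}"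
proof (induction vs rule: path_edges.induct)
  case (1 u v vs)
  have "{{(u # v # vs) ! i, (u # v # vs) ! Suc i} | i. Suc i < length (u # v # vs)}
     = insert {u, v} {{(v # vs) ! i, (v # vs) ! Suc i} | i. Suc i < length (v # vs)}"
    (is "?L = ?R")
  proof
    show "?L \<subseteq> ?R"
    proof
      fix e assume "e \<in> ?L"
      then obtain i where "Suc i < length (u # v # vs)" "e = {(u # v # vs) ! i, (u # v # vs) ! Suc i}"
        by blast
      then show "e \<in> ?R" by (cases i) auto
    qed
    show "?R \<subseteq> ?L"
    proof
      fix e assume "e \<in> ?R"
      then consider "e = {u, v}" | i where "Suc i < length (v # vs)" "e = {(v # vs) ! i, (v # vs) ! Suc i}"
        by blast
      then show "e \<in> ?L"
      proof cases
        case 1 then show ?thesis by (auto intro!: exI[of _ 0])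
      next
        case 2 then show ?thesis by (auto intro!: exI[of _ "Suc i"])
      qed
    qed
  qed
  then show ?case using 1 by simp
qed auto

lemma cycle_edges_conv_path_edges:
  assumes "c \<noteq> []"
  shows "cycle_edges c = insert {last c, hd c} (path_edges c)"
proof -
  have n: "length c > 0" using assms by simp
  show ?thesis
  proof (rule set_eqI)
    fix e
    have "e \<in> cycle_edges c \<longleftrightarrow> (\<exists>i. (Suc i = length c \<or> Suc i < length c) \<and> e = {c ! i, c ! (Suc i mod length c)})"
    proof -
      have "(Suc i = length c \<or> Suc i < length c) \<longleftrightarrow> i < length c" for i by linarith
      then show ?thesis unfolding cycle_edges_def by blast
    qed
    also have "\<dots> \<longleftrightarrow> e = {c ! (length c - 1), c ! 0} \<or> (\<exists>i. Suc i < length c \<and> e = {c ! i, c ! Suc i})"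
    proof
      assume "\<exists>i. (Suc i = length c \<or> Suc i < length c) \<and> e = {c ! i, c ! (Suc i mod length c)}"
      then obtain i where i: "Suc i = length c \<or> Suc i < length c" "e = {c ! i, c ! (Suc i mod length c)}"
        by blast
      show "e = {c ! (length c - 1), c ! 0} \<or> (\<exists>i. Suc i < length c \<and> e = {c ! i, c ! Suc i})"
      proof (cases "Suc i = length c")
        case True
        then have "i = length c - 1" by simp
        then show ?thesis using i True by simp
      qed (use i in auto)
    next
      assume "e = {c ! (length c - 1), c ! 0} \<or> (\<exists>i. Suc i < length c \<and> e = {c ! i, c ! Suc i})"
      then show "\<exists>i. (Suc i = length c \<or> Suc i < length c) \<and> e = {c ! i, c ! (Suc i mod length c)}"
      proof
        assume "e = {c ! (length c - 1), c ! 0}"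
        then show ?thesis using n by (intro exI[of _ "length c - 1"]) simp
      next
        assume "\<exists>i. Suc i < length c \<and> e = {c ! i, c ! Suc i}"
        then obtain i where "Suc i < length c" "e = {c ! i, c ! Suc i}" by blast
        then show ?thesis by (intro exI[of _ i]) simp
      qed
    qed
    also have "\<dots> \<longleftrightarrow> e \<in> insert {last c, hd c} (path_edges c)"
      unfolding path_edges_conv_nth last_conv_nth[OF assms] hd_conv_nth[OF assms] by blast
    finally show "e \<in> cycle_edges c \<longleftrightarrow> e \<in> insert {last c, hd c} (path_edges c)" .
  qed
qed

lemma path_edges_snoc:
  "vs \<noteq> [] \<Longrightarrow> path_edges (vs @ [x]) = insert {last vs, x} (path_edges vs)"
  by (induction vs rule: path_edges.induct) auto

lemma cycle_edges_rotate: "cycle_edges (rotate k c) = cycle_edges c"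
proof -
  have "cycle_edges (rotate1 vs) = cycle_edges vs" for vs
  proof (cases vs)
    case (Cons x xs)
    show ?thesis
    proof (cases xs)
      case Nil
      then show ?thesis using Cons by simp
    next
      case (Cons y ys)
      have "cycle_edges (rotate1 vs) = insert {x, y} (path_edges (xs @ [x]))"
        using \<open>vs = x # xs\<close> Cons cycle_edges_conv_path_edges[of "xs @ [x]"] by simp
      also have "\<dots> = insert {x, y} (insert {last xs, x} (path_edges xs))"
        using Cons path_edges_snoc[of xs x] by simp
      also have "\<dots> = cycle_edges vs"
        using \<open>vs = x # xs\<close> Cons cycle_edges_conv_path_edges[of vs] by (simp add: insert_commute)
      finally show ?thesis .
    qed
  qed simp
  then show ?thesis by (induction k) (simp_all add: rotate_def)
qed

text \<open>Any edge of a cycle can be made the closing edge by rotating the list of vertices. The length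
  bound keeps the closing edge from coinciding with an edge of the remaining path.\<close>

lemma cycle_edges_split:
  assumes "e \<in> cycle_edges c" "length c \<ge> 3" "distinct c"
  obtains c' where "distinct c'" "set c' = set c" "length c' = length c"
    "e = {last c', hd c'}" "cycle_edges c = insert e (path_edges c')" "e \<notin> path_edges c'"
proof -
  define n where "n = length c"
  have n: "n \<ge> 3" using assms n_def by simp
  obtain i where i: "i < n" "e = {c ! i, c ! (Suc i mod n)}"
    using assms(1) by (auto simp: cycle_edges_def n_def)
  define c' where "c' = rotate (Suc i) c"
  have c': "distinct c'" "set c' = set c" "length c' = n" "c' \<noteq> []"
    using assms n by (auto simp: c'_def n_def)
  have nth: "c' ! k = c ! ((Suc i + k) mod n)" if "k < n" for k
    unfolding c'_def n_def using that by (intro nth_rotate) (simp add: n_def)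
  have "hd c' = c ! (Suc i mod n)"
    using c' n nth[of 0] by (simp add: hd_conv_nth)
  moreover have "last c' = c ! i"
  proof -
    have "last c' = c ! ((Suc i + (n - 1)) mod n)"
      using c' n nth[of "n - 1"] by (simp add: last_conv_nth)
    also have "Suc i + (n - 1) = i + n" using n by simp
    finally show ?thesis using i by simp
  qed
  ultimately have e: "e = {last c', hd c'}" using i by simp
  have ce: "cycle_edges c = insert e (path_edges c')"
    using cycle_edges_conv_path_edges[OF c'(4)] cycle_edges_rotate[of "Suc i" c] e
    by (simp add: c'_def)
  have "e \<notin> path_edges c'"
  proof
    assume "e \<in> path_edges c'"
    then obtain k where k: "Suc k < n" "{c' ! (n - 1), c' ! 0} = {c' ! k, c' ! Suc k}"
      using e c' by (auto simp: path_edges_conv_nth last_conv_nth hd_conv_nth)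
    have "c' ! (n - 1) = c' ! k \<and> c' ! 0 = c' ! Suc k \<or> c' ! (n - 1) = c' ! Suc k \<and> c' ! 0 = c' ! k"
      using k(2) by (simp only: doubleton_eq_iff)
    then have "n - 1 = k \<and> 0 = Suc k \<or> n - 1 = Suc k \<and> 0 = k"
      using k(1) n c'(3) nth_eq_iff_index_eq[OF c'(1), of "n - 1" k]
        nth_eq_iff_index_eq[OF c'(1), of "n - 1" "Suc k"] nth_eq_iff_index_eq[OF c'(1), of 0 "Suc k"] nth_eq_iff_index_eq[OF c'(1), of 0 k] by auto
    then show False using n by linarith
  qed
  then show ?thesis using that[of c'] c' e ce by (simp add: n_def)
qed

lemma plane_graphD:
  assumes "plane_graph G" "e \<in> edges G"
  shows "e \<subseteq> verts G" "arc (drawing G e)"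
    "{pathstart (drawing G e), pathfinish (drawing G e)} = e" "edge_arc G e \<inter> verts G = e"
    "e' \<in> edges G \<Longrightarrow> e \<noteq> e' \<Longrightarrow> edge_arc G e \<inter> edge_arc G e' = e \<inter> e'"
proof -
  have *: "e \<subseteq> verts G \<and> arc (drawing G e) \<and>
        {pathstart (drawing G e), pathfinish (drawing G e)} = e \<and> edge_arc G e \<inter> verts G = e"
    using assms(1) unfolding plane_graph_def by (elim conjE) (rule bspec[OF _ assms(2)])
  then show "e \<subseteq> verts G" "arc (drawing G e)"
    "{pathstart (drawing G e), pathfinish (drawing G e)} = e" "edge_arc G e \<inter> verts G = e"
    by simp_all
  show "edge_arc G e \<inter> edge_arc G e' = e \<inter> e'" if "e' \<in> edges G" "e \<noteq> e'"
    using assms that unfolding plane_graph_def by simp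
qed

lemma edge_doubleton:
  assumes "plane_graph G" "e \<in> edges G"
  obtains u v where "e = {u, v}" "u \<noteq> v"
  using that[OF plane_graphD(3)[OF assms, symmetric] arc_distinct_ends[OF plane_graphD(2)[OF assms], symmetric]] .

lemma edge_ends_distinct: "plane_graph G \<Longrightarrow> {u, v} \<in> edges G \<Longrightarrow> u \<noteq> v"
  by (erule (1) edge_doubleton) (auto simp: doubleton_eq_iff)

lemma finite_edges: "plane_graph G \<Longrightarrow> finite (edges G)"
  by (rule finite_subset[of _ "Pow (verts G)"]) (auto simp: plane_graph_def)

text \<open>A drawing fixes a direction for each edge; walking along a path may need the opposite one.\<close>

lemma oriented_edge_arc:
  assumes "plane_graph G" "{u, v} \<in> edges G"
  obtains g where "arc g" "pathstart g = u" "pathfinish g = v" "path_image g = edge_arc G {u, v}"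
proof -
  note e = plane_graphD(2,3)[OF assms]
  consider "pathstart (drawing G {u, v}) = u" "pathfinish (drawing G {u, v}) = v"
    | "pathstart (drawing G {u, v}) = v" "pathfinish (drawing G {u, v}) = u"
    using e(2) by (auto simp: doubleton_eq_iff)
  then show ?thesis
  proof cases
    case 1
    then show ?thesis using that e(1) by blast
  next
    case 2
    then show ?thesis using that[of "reversepath (drawing G {u, v})"] e(1)
      by (simp add: arc_reversepath)
  qed
qed

lemma path_edges_subset_set: "e \<in> path_edges vs \<Longrightarrow> e \<subseteq> set vs"
  by (induction vs rule: path_edges.induct) auto

lemma cycle_edges_subset_set: "e \<in> cycle_edges c \<Longrightarrow> e \<subseteq> set c"
proof -
  assume "e \<in> cycle_edges c"
  moreover from this have "c \<noteq> []" by (auto simp: cycle_edges_def)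
  ultimately show "e \<subseteq> set c"
    using path_edges_subset_set[of e c] by (auto simp: cycle_edges_conv_path_edges)
qed

lemma path_drawn_as_arc:
  assumes "plane_graph G" "distinct vs" "length vs \<ge> 2" "path_edges vs \<subseteq> edges G"
  shows "\<exists>g. arc g \<and> pathstart g = hd vs \<and> pathfinish g = last vs \<and>
    path_image g = (\<Union>e\<in>path_edges vs. edge_arc G e)"
  using assms(2-)
proof (induction vs rule: path_edges.induct)
  case (1 u v vs)
  have uv: "{u, v} \<in> edges G" using 1 by simp
  obtain g where g: "arc g" "pathstart g = u" "pathfinish g = v" "path_image g = edge_arc G {u, v}"
    using oriented_edge_arc[OF assms(1) uv] .
  show ?case
  proof (cases "vs = []")
    case True
    then show ?thesis using g by auto
  next
    case False
    then have "\<exists>g. arc g \<and> pathstart g = v \<and> pathfinish g = last vs \<and>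
        path_image g = (\<Union>e\<in>path_edges (v # vs). edge_arc G e)"
      using 1 by (cases vs) auto
    then obtain h where h: "arc h" "pathstart h = v" "pathfinish h = last vs"
        "path_image h = (\<Union>e\<in>path_edges (v # vs). edge_arc G e)"
      by blast
    have "edge_arc G {u, v} \<inter> edge_arc G e \<subseteq> {v}" if e: "e \<in> path_edges (v # vs)" for e
    proof -
      have "u \<notin> e" using path_edges_subset_set[OF e] 1 by auto
      moreover have "e \<in> edges G" using e 1 by auto
      moreover have "{u, v} \<noteq> e" using \<open>u \<notin> e\<close> by blast
      ultimately have "edge_arc G {u, v} \<inter> edge_arc G e = {u, v} \<inter> e"
        using plane_graphD(5)[OF assms(1) uv] by blast
      then show ?thesis using \<open>u \<notin> e\<close> by auto
    qed
    then have "path_image g \<inter> path_image h \<subseteq> {pathstart h}"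
      using g h by auto
    then have "arc (g +++ h)" using g h by (intro arc_join) auto
    moreover have "path_image (g +++ h) = (\<Union>e\<in>path_edges (u # v # vs). edge_arc G e)"
      using g h by (simp add: path_image_join)
    ultimately show ?thesis using g h False by (intro exI[of _ "g +++ h"]) auto
  qed
qed auto

text \<open>Besides the closed curve itself, what is left of it after removing one edge is recorded: a connected
  set containing both ends of that edge. This is the connected intersection that Janiszewski's theorem
  asks for.\<close>

lemma cycle_drawn_as_closed_curve:
  assumes "plane_graph G" "is_cycle G c" "e \<in> cycle_edges c"
  obtains g where "simple_path g" "pathfinish g = pathstart g"
    "path_image g = (\<Union>e\<in>cycle_edges c. edge_arc G e)"
    "connected (\<Union>e'\<in>cycle_edges c - {e}. edge_arc G e')"
    "e \<subseteq> (\<Union>e'\<in>cycle_edges c - {e}. edge_arc G e')"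
proof -
  have c: "length c \<ge> 3" "distinct c" "cycle_edges c \<subseteq> edges G"
    using assms(2) by (auto simp: is_cycle_def)
  obtain c' where c': "distinct c'" "set c' = set c" "length c' = length c"
    "e = {last c', hd c'}" "cycle_edges c = insert e (path_edges c')" "e \<notin> path_edges c'"
    using cycle_edges_split[OF assms(3) c(1,2)] .
  have "\<exists>g. arc g \<and> pathstart g = hd c' \<and> pathfinish g = last c' \<and>
    path_image g = (\<Union>e\<in>path_edges c'. edge_arc G e)"
    using c' c by (intro path_drawn_as_arc[OF assms(1)]) auto
  then obtain r where r: "arc r" "pathstart r = hd c'" "pathfinish r = last c'"
    "path_image r = (\<Union>e\<in>path_edges c'. edge_arc G e)" by blast
  have e: "{last c', hd c'} \<in> edges G" using c' c by blast
  obtain g where g: "arc g" "pathstart g = last c'" "pathfinish g = hd c'"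
    "path_image g = edge_arc G {last c', hd c'}"
    using oriented_edge_arc[OF assms(1) e] .
  have "edge_arc G e \<inter> edge_arc G e' \<subseteq> e" if "e' \<in> path_edges c'" for e'
  proof -
    have "e' \<in> edges G" "e \<noteq> e'" using that c c' by auto
    then show ?thesis using plane_graphD(5)[OF assms(1), of e e'] e c'(4) by blast
  qed
  then have int: "path_image g \<inter> path_image r \<subseteq> {pathstart g, pathstart r}"
    using g r c'(4) by auto
  have sp: "simple_path (g +++ r)"
    using g r int by (intro simple_path_join_loop) auto
  have diff: "cycle_edges c - {e} = path_edges c'" using c' by blast
  show ?thesis
  proof (rule that[of "g +++ r"])
    show "path_image (g +++ r) = (\<Union>e\<in>cycle_edges c. edge_arc G e)"
      using g r c' by (simp add: path_image_join)
    show "connected (\<Union>e'\<in>cycle_edges c - {e}. edge_arc G e')"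
      unfolding diff r(4)[symmetric] using r(1) by (simp add: connected_arc_image)
    show "e \<subseteq> (\<Union>e'\<in>cycle_edges c - {e}. edge_arc G e')"
      using pathstart_in_path_image[of r] pathfinish_in_path_image[of r] r(2-4) c'(4)
      unfolding diff by simp
  qed (use g r sp in auto)
qed

section \<open>Faces and edges of a plane graph\<close>

lemma compact_point_set: "plane_graph G \<Longrightarrow> compact (point_set G)"
  unfolding point_set_def
  by (intro compact_Un compact_UN finite_imp_compact finite_edges compact_arc_image plane_graphD(2))
    (auto simp: plane_graph_def)

lemma faceD:
  assumes "plane_graph G" "F \<in> faces G"
  shows "open F" "connected F" "F \<noteq> {}" "F \<inter> point_set G = {}" "frontier F \<subseteq> point_set G"
proof -
  have c: "closed (point_set G)" using compact_point_set[OF assms(1)] by (rule compact_imp_closed)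
  have F: "F \<in> components (- point_set G)" using assms by (simp add: faces_def)
  show "open F" using open_components[OF _ F] c by auto
  show "connected F" "F \<noteq> {}" "F \<inter> point_set G = {}"
    using in_components_connected[OF F] in_components_nonempty[OF F] in_components_subset[OF F] by auto
  show "frontier F \<subseteq> point_set G" using frontier_of_components_closed_complement[OF c F] .
qed

lemma faces_disjoint: "F \<in> faces G \<Longrightarrow> F' \<in> faces G \<Longrightarrow> F \<noteq> F' \<Longrightarrow> F \<inter> F' = {}"
  unfolding faces_def using components_nonoverlap by blast

lemma edge_has_inner_point:
  assumes "plane_graph G" "e \<in> edges G"
  obtains p where "p \<in> edge_arc G e" "p \<notin> verts G"
proof -
  note a = plane_graphD(2)[OF assms]
  define p where "p = drawing G e (1/2)"
  have inj: "inj_on (drawing G e) {0..1}" using a by (simp add: arc_def)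
  have "p \<noteq> pathstart (drawing G e)" "p \<noteq> pathfinish (drawing G e)"
    using inj_onD[OF inj, of "1/2" 0] inj_onD[OF inj, of "1/2" 1]
    by (auto simp: p_def pathstart_def pathfinish_def)
  then have "p \<notin> e" using plane_graphD(3)[OF assms] by blast
  moreover have "p \<in> edge_arc G e" by (auto simp: p_def path_image_def)
  ultimately show ?thesis using that[of p] plane_graphD(4)[OF assms] by auto
qed

text \<open>Together with \<open>edge_has_inner_point\<close> this lets a single point detect an edge: a union of edge arcs
  through an inner point of \<open>e\<close> contains all of \<open>e\<close>.\<close>

lemma inner_point_unique_edge:
  assumes "plane_graph G" "e \<in> edges G" "e' \<in> edges G" "p \<in> edge_arc G e" "p \<in> edge_arc G e'" "p \<notin> verts G"
  shows "e = e'"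
proof (rule ccontr)
  assume "e \<noteq> e'"
  then have "p \<in> e" using plane_graphD(5)[OF assms(1-3)] assms(4,5) by auto
  then show False using plane_graphD(1)[OF assms(1,2)] assms(6) by auto
qed

lemma face_edges_of_facial_cycle:
  assumes "plane_graph G" "facial_cycle G F c"
  shows "face_edges G F = cycle_edges c"
proof
  have fr: "frontier F = (\<Union>e\<in>cycle_edges c. edge_arc G e)" and ce: "cycle_edges c \<subseteq> edges G"
    using assms(2) by (auto simp: facial_cycle_def is_cycle_def)
  show "cycle_edges c \<subseteq> face_edges G F" using fr ce by (auto simp: face_edges_def)
  show "face_edges G F \<subseteq> cycle_edges c"
  proof
    fix e assume "e \<in> face_edges G F"
    then have e: "e \<in> edges G" "edge_arc G e \<subseteq> frontier F" by (auto simp: face_edges_def)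
    obtain p where p: "p \<in> edge_arc G e" "p \<notin> verts G" using edge_has_inner_point[OF assms(1) e(1)] .
    obtain e' where e': "e' \<in> cycle_edges c" "p \<in> edge_arc G e'" using p e fr by blast
    then have "e = e'" using inner_point_unique_edge[OF assms(1) e(1)] p ce by blast
    then show "e \<in> cycle_edges c" using e' by simp
  qed
qed

lemma inner_point_on_frontier:
  assumes "plane_graph G" "facial_cycle G F c" "e \<in> edges G" "p \<in> edge_arc G e" "p \<notin> verts G"
    "p \<in> frontier F"
  shows "e \<in> face_edges G F"
proof -
  have fr: "frontier F = (\<Union>e\<in>cycle_edges c. edge_arc G e)" and ce: "cycle_edges c \<subseteq> edges G"
    using assms(2) by (auto simp: facial_cycle_def is_cycle_def)
  obtain e' where e': "e' \<in> cycle_edges c" "p \<in> edge_arc G e'" using assms(6) fr by blast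
  then have "e = e'" using inner_point_unique_edge[OF assms(1,3)] assms(4,5) ce by blast
  then show ?thesis using e' face_edges_of_facial_cycle[OF assms(1,2)] by simp
qed

text \<open>A face is a connected subset of the complement of its boundary curve, hence lies in one of the two
  Jordan domains, and it fills that domain because the domain does not meet the frontier of the face.
  The other domain is \<open>D\<close>.\<close>

lemma face_is_Jordan_domain:
  assumes "plane_graph G" "F \<in> faces G" "facial_cycle G F c"
  obtains D where "open D" "connected D" "- frontier F = F \<union> D" "F \<inter> D = {}" "frontier D = frontier F"
proof -
  have c: "is_cycle G c" and fr: "frontier F = (\<Union>e\<in>cycle_edges c. edge_arc G e)"
    using assms(3) by (auto simp: facial_cycle_def)
  have "cycle_edges c \<noteq> {}" using c by (auto simp: is_cycle_def cycle_edges_def intro!: exI[of _ 0])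
  then obtain e where e: "e \<in> cycle_edges c" by blast
  obtain g where g: "simple_path g" "pathfinish g = pathstart g" "path_image g = frontier F"
    using cycle_drawn_as_closed_curve[OF assms(1) c e] unfolding fr by metis
  define I D where "I = inside (frontier F)" and "D = outside (frontier F)"
  have J: "open I" "connected I" "open D" "connected D" "I \<inter> D = {}" "I \<union> D = - frontier F"
    "frontier I = frontier F" "frontier D = frontier F"
    using Jordan_inside_outside[OF g(1,2)] unfolding g(3) I_def D_def by blast+
  note F = faceD[OF assms(1,2)]
  have sub: "F \<subseteq> I \<union> D" using F(1) J(6) frontier_disjoint_eq[of F] by blast
  have eq: "U = F" if "F \<inter> U \<noteq> {}" "F \<inter> V = {}" "connected U" "F \<subseteq> U \<union> V" "U \<inter> frontier F = {}" for U V
  proof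
    show "F \<subseteq> U" using that by blast
    show "U \<subseteq> F" using connected_Int_frontier[OF that(3), of F] that(1,5) by blast
  qed
  have "F \<inter> I = {} \<or> F \<inter> D = {}"
    using connectedD[OF F(2) J(1,3)] sub J(5) by blast
  then show ?thesis
  proof
    assume 0: "F \<inter> I = {}"
    then have "D = F" using eq[of D I] sub J F(3) by blast
    then show ?thesis using that[of I] J by blast
  next
    assume 0: "F \<inter> D = {}"
    then have "I = F" using eq[of I D] sub J F(3) by blast
    then show ?thesis using that[of D] J by blast
  qed
qed

text \<open>The second face lies on the far side \<open>D\<close> of the first face's curve. It fills \<open>D\<close>, since its own
  frontier does not enter \<open>D\<close>. So the two faces cover the complement of the curve, and nothing of the
  drawing is left outside the curve.\<close>

lemma point_set_subset_nested_frontier: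
  assumes "plane_graph G" "F \<in> faces G" "facial_cycle G F c" "F' \<in> faces G" "F \<noteq> F'"
    "frontier F' \<subseteq> frontier F"
  shows "point_set G \<subseteq> frontier F"
proof -
  obtain D where D: "open D" "connected D" "- frontier F = F \<union> D" "F \<inter> D = {}" "frontier D = frontier F"
    using face_is_Jordan_domain[OF assms(1-3)] .
  note F = faceD[OF assms(1,2)] and F' = faceD[OF assms(1,4)]
  have "F' \<inter> frontier F = {}" using F(5) F'(4) by blast
  then have "F' \<subseteq> D" using D(3) faces_disjoint[OF assms(2,4,5)] by blast
  moreover have "D \<subseteq> F'"
  proof (rule ccontr)
    assume "\<not> D \<subseteq> F'"
    then have "D \<inter> frontier F' \<noteq> {}"
      using connected_Int_frontier[OF D(2), of F'] \<open>F' \<subseteq> D\<close> F'(3) by blast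
    then show False using assms(6) D(3) by blast
  qed
  ultimately show ?thesis using D(3) F(4) F'(4) by blast
qed

text \<open>Removing the edge from the drawing leaves a compact set \<open>P'\<close> which a small ball around an inner
  point \<open>p\<close> of the edge avoids. For existence, points of the ball on both sides of the Jordan
  curve of one face lead to two faces. For uniqueness, a third face and the second one are joined
  through \<open>p\<close> outside \<open>P'\<close>, and they are joined in the far Jordan domain of the first face; as
  \<open>P'\<close> meets the curve in an arc, Janiszewski's theorem joins them outside the whole drawing.\<close>

lemma edge_on_exactly_two_faces:
  assumes G: "plane_graph G" and fc: "\<And>F. F \<in> faces G \<Longrightarrow> \<exists>c. facial_cycle G F c"
    and e: "e \<in> edges G"
  shows "card {F \<in> faces G. e \<in> face_edges G F} = 2"
proof -
  define P where "P = point_set G"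
  define P' where "P' = verts G \<union> (\<Union>e'\<in>edges G - {e}. edge_arc G e')"
  obtain p where p: "p \<in> edge_arc G e" "p \<notin> verts G" using edge_has_inner_point[OF G e] .
  have P: "P = P' \<union> edge_arc G e" using e by (auto simp: P_def P'_def point_set_def)
  have cP': "compact P'" unfolding P'_def
    by (intro compact_Un compact_UN finite_imp_compact finite_Diff finite_edges[OF G] compact_arc_image
        plane_graphD(2)[OF G]) (use G in \<open>auto simp: plane_graph_def\<close>)
  have "p \<notin> P'" using p inner_point_unique_edge[OF G e] by (auto simp: P'_def)
  then obtain r where r: "r > 0" "ball p r \<inter> P' = {}"
    using open_contains_ball[of "- P'"] compact_imp_closed[OF cP'] open_Compl[of P'] by blast
  \<comment> \<open>The segment from \<open>q\<close> to the edge stays in the ball, so the face of \<open>q\<close> is left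
    at an inner point of this edge.\<close>
  have reach: "\<exists>F\<in>faces G. q \<in> F \<and> e \<in> face_edges G F" if q: "q \<in> ball p r" "q \<notin> P" for q
  proof -
    obtain F where F: "F \<in> faces G" "q \<in> F"
      using q(2) Union_components[of "- P"] unfolding faces_def P_def by blast
    have "p \<in> P" using p P by simp
    then have "p \<notin> F" using faceD(4)[OF G F(1)] by (auto simp: P_def)
    have "closed_segment q p \<inter> frontier F \<noteq> {}"
      using F \<open>p \<notin> F\<close> by (intro connected_Int_frontier) auto
    then obtain p' where p': "p' \<in> closed_segment q p" "p' \<in> frontier F" by blast
    have "p' \<in> ball p r" using p'(1) q(1) r(1)
      using closed_segment_subset[OF q(1) _ convex_ball, of p] by auto
    then have "p' \<in> edge_arc G e" "p' \<notin> verts G"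
      using r(2) faceD(5)[OF G F(1)] p'(2) P by (auto simp: P_def P'_def)
    moreover obtain c where "facial_cycle G F c" using fc[OF F(1)] by blast
    ultimately show ?thesis using inner_point_on_frontier[OF G _ e _ _ p'(2)] F by blast
  qed
  have "\<not> ball p r \<subseteq> edge_arc G e"
    using interior_arc_image_empty[OF plane_graphD(2)[OF G e]] interior_maximal[of "ball p r" "edge_arc G e"]
      centre_in_ball[of p r] r(1) by blast
  then obtain q1 where q1: "q1 \<in> ball p r" "q1 \<notin> P" using r(2) P by blast
  obtain F1 where F1: "F1 \<in> faces G" "e \<in> face_edges G F1" using reach[OF q1] by blast
  obtain c1 where c1: "facial_cycle G F1 c1" using fc[OF F1(1)] by blast
  obtain D where D: "open D" "connected D" "- frontier F1 = F1 \<union> D" "F1 \<inter> D = {}" "frontier D = frontier F1"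
    using face_is_Jordan_domain[OF G F1(1) c1] .
  have e_sub: "edge_arc G e \<subseteq> frontier F1" using F1(2) by (auto simp: face_edges_def)
  obtain q2 where q2: "q2 \<in> ball p r" "q2 \<in> D"
  proof -
    have "p \<in> closure D" using e_sub p(1) D(5) by (auto simp: frontier_def)
    then obtain y where "y \<in> D" "dist y p < r" using r(1) unfolding closure_approachable by blast
    then show ?thesis using that[of y] by (simp add: dist_commute)
  qed
  have "q2 \<notin> P" using q2 r(2) D(3) P e_sub by blast
  then obtain F2 where F2: "F2 \<in> faces G" "q2 \<in> F2" "e \<in> face_edges G F2" using reach[OF q2(1)] by blast
  have "F2 \<noteq> F1" using F2(2) q2(2) D(4) by blast
  have at_most: "F \<in> {F1, F2}" if F: "F \<in> faces G" "e \<in> face_edges G F" for F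
  proof (rule ccontr)
    assume "F \<notin> {F1, F2}"
    obtain x where x: "x \<in> F" using faceD(3)[OF G F(1)] by blast
    have out: "H \<subseteq> D" if "H \<in> faces G" "H \<noteq> F1" for H
      using faces_disjoint[OF that(1) F1(1) that(2)] faceD(4)[OF G that(1)] faceD(5)[OF G F1(1)] D(3) by blast
    have c: "is_cycle G c1" "e \<in> cycle_edges c1"
      and fr: "frontier F1 = (\<Union>e\<in>cycle_edges c1. edge_arc G e)"
      using c1 F1(2) face_edges_of_facial_cycle[OF G c1] by (auto simp: facial_cycle_def)
    have ce: "cycle_edges c1 \<subseteq> edges G" using c(1) by (simp add: is_cycle_def)
    obtain g where con: "connected (\<Union>e'\<in>cycle_edges c1 - {e}. edge_arc G e')"
      and sub: "e \<subseteq> (\<Union>e'\<in>cycle_edges c1 - {e}. edge_arc G e')"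
      using cycle_drawn_as_closed_curve[OF G c] .
    \<comment> \<open>The arc \<open>e\<close> contributes only its two ends to the intersection, and these
      already lie on the rest of the cycle.\<close>
    have "P' \<inter> frontier F1 = (\<Union>e'\<in>cycle_edges c1 - {e}. edge_arc G e')" (is "_ = ?R")
    proof
      show "?R \<subseteq> P' \<inter> frontier F1" using ce fr by (auto simp: P'_def)
      have "y \<in> ?R" if "y \<in> P'" "y \<in> edge_arc G e" for y
      proof -
        have "y \<in> verts G"
          using that inner_point_unique_edge[OF G e _ that(2)] by (auto simp: P'_def)
        then have "y \<in> e" using plane_graphD(4)[OF G e] that(2) by blast
        then show ?thesis using sub by blast
      qed
      then show "P' \<inter> frontier F1 \<subseteq> ?R" unfolding fr by blast
    qed
    then have 1: "connected (P' \<inter> frontier F1)" using con by simp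
    have 2: "connected_component (- P') x q2"
    proof -
      have "connected (insert p H)" if "H \<in> faces G" "e \<in> face_edges G H" for H
      proof (rule connected_intermediate_closure[OF faceD(2)[OF G that(1)]])
        have "p \<in> frontier H" using that(2) p(1) by (auto simp: face_edges_def)
        then show "insert p H \<subseteq> closure H" using closure_subset[of H] by (auto simp: frontier_def)
      qed auto
      then have "connected (insert p F)" "connected (insert p F2)" using F F2 by blast+
      then have "connected (insert p F \<union> insert p F2)" by (intro connected_Un) auto
      moreover have "insert p F \<union> insert p F2 \<subseteq> - P'"
        using \<open>p \<notin> P'\<close> faceD(4)[OF G F(1)] faceD(4)[OF G F2(1)] P by (auto simp: P_def)
      ultimately show ?thesis using x F2(2) unfolding connected_component_def by blast
    qed
    have 3: "connected_component (- frontier F1) x q2"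
      using D(2,3) q2(2) out[OF F(1)] x \<open>F \<notin> {F1, F2}\<close> unfolding connected_component_def by blast
    have "P' \<union> frontier F1 = P"
      using faceD(5)[OF G F1(1)] e_sub P by (auto simp: P_def)
    then have "connected_component (- P) x q2"
      using Janiszewski[OF cP' frontier_closed 1 2 3] by simp
    then obtain C where C: "connected C" "C \<subseteq> - P" "x \<in> C" "q2 \<in> C"
      unfolding connected_component_def by blast
    then have "F = F2"
      using joinable_components_eq[of C "- P" F F2] F(1) F2(1,2) x by (auto simp: faces_def P_def)
    then show False using \<open>F \<notin> {F1, F2}\<close> by simp
  qed
  then have "{F \<in> faces G. e \<in> face_edges G F} = {F1, F2}" using F1 F2 by blast
  then show ?thesis using \<open>F2 \<noteq> F1\<close> by simp
qed

section \<open>Parity sequences and closed sequences of colours\<close>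

definition color_pairs :: "(nat \<times> nat) set" where
  "color_pairs = {(u, v). u < 3 \<and> v < 3 \<and> u \<noteq> v}"

text \<open>For distinct colours among 0, 1, 2 the remaining one is what is missing from their sum 3.\<close>

definition third :: "nat \<Rightarrow> nat \<Rightarrow> nat" where
  "third u v = 3 - u - v"

text \<open>The pair consists of the colours of two consecutive apexes \<open>f (j - 1)\<close> and \<open>f j\<close>; the letter is the
  parity of the fan \<open>F j\<close>. The vertices of the fan other than \<open>f j\<close> form a path from \<open>f (j - 1)\<close> to
  \<open>f (j + 1)\<close> on which the two colours different from that of \<open>f j\<close> alternate.\<close>

fun fan_step :: "bit \<Rightarrow> nat \<times> nat \<Rightarrow> nat \<times> nat" where
  "fan_step p (u, v) = (v, if p = 0 then u else third u v)"

text \<open>The condition for a cyclic sequence of fans with these parities to admit a consistent colouring of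
  the apexes.\<close>

definition closes_up :: "parity_seq \<Rightarrow> bool" where
  "closes_up p \<longleftrightarrow> (\<exists>s \<in> color_pairs. fold fan_step p s = s)"

lemma third_color:
  assumes "u < 3" "v < 3" "u \<noteq> v"
  shows "third u v < 3" "third u v \<noteq> u" "third u v \<noteq> v" "third v u = third u v"
    "third (third u v) v = u" "third v (third u v) = u" "third (third u v) u = v" "third u (third u v) = v"
proof -
  have "u \<in> {0, 1, 2}" "v \<in> {0, 1, 2}" using assms by auto
  then show "third u v < 3" "third u v \<noteq> u" "third u v \<noteq> v" "third v u = third u v"
    "third (third u v) v = u" "third v (third u v) = u" "third (third u v) u = v" "third u (third u v) = v"
    using assms(3) by (auto simp: third_def)
qed

lemma third_unique:
  "u < 3 \<Longrightarrow> v < 3 \<Longrightarrow> w < 3 \<Longrightarrow> u \<noteq> v \<Longrightarrow> w \<noteq> u \<Longrightarrow> w \<noteq> v \<Longrightarrow> w = third u v"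
proof -
  assume a: "u < 3" "v < 3" "w < 3" "u \<noteq> v" "w \<noteq> u" "w \<noteq> v"
  then have "u \<in> {0, 1, 2}" "v \<in> {0, 1, 2}" "w \<in> {0, 1, 2}" by auto
  then show ?thesis using a(4-) by (auto simp: third_def)
qed

lemma fan_step_in_color_pairs: "s \<in> color_pairs \<Longrightarrow> fan_step p s \<in> color_pairs"
proof -
  assume "s \<in> color_pairs"
  then obtain u v where s: "s = (u, v)" "u < 3" "v < 3" "u \<noteq> v" by (auto simp: color_pairs_def)
  show ?thesis using s third_color(1,3)[OF s(2-4)] by (auto simp: color_pairs_def)
qed

lemma fold_fan_step_in_color_pairs: "s \<in> color_pairs \<Longrightarrow> fold fan_step p s \<in> color_pairs"
  by (induction p arbitrary: s) (auto simp: fan_step_in_color_pairs)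

text \<open>A starting pair fixed by the composite action is carried to one for the rotated sequence by the
  action of the letter that is moved.\<close>

lemma closes_up_rotate: "closes_up (rotate k p) \<longleftrightarrow> closes_up p"
proof -
  have imp: "closes_up (xs @ [x])" if closed: "closes_up (x # xs)" for x xs
  proof -
    obtain s where s: "s \<in> color_pairs" "fold fan_step xs (fan_step x s) = s"
      using closed by (auto simp: closes_up_def)
    then show ?thesis
      unfolding closes_up_def by (intro bexI[of _ "fan_step x s"]) (auto simp: fan_step_in_color_pairs)
  qed
  have imp': "closes_up (x # xs)" if closed: "closes_up (xs @ [x])" for x xs
  proof -
    obtain s where s: "s \<in> color_pairs" "fan_step x (fold fan_step xs s) = s"
      using closed by (auto simp: closes_up_def)
    then show ?thesis
      unfolding closes_up_def
      by (intro bexI[of _ "fold fan_step xs s"]) (auto simp: fold_fan_step_in_color_pairs)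
  qed
  have "closes_up (rotate1 p) \<longleftrightarrow> closes_up p" for p
    using imp imp' by (cases p) auto
  then show ?thesis by (induction k) (auto simp: rotate_def)
qed

text \<open>The reason behind e-collapses: an even letter swaps the pair, so that the letters before and after
  it replace the same colour, while the other colour stays. Two replacements by the third colour cancel.\<close>

lemma fan_step_around_even:
  assumes "s \<in> color_pairs"
  shows "fan_step b (fan_step 0 (fan_step a s)) = fan_step (a + b) s"
  using assms by (cases s; cases a; cases b) (auto simp: color_pairs_def third_color)

text \<open>The rotation that starts one place before \<open>j\<close>; the amount \<open>j + n - 1\<close> is \<open>j - 1\<close> modulo \<open>n\<close>
  without truncation at \<open>j = 0\<close>.\<close>

lemma rotate_to_letter:
  assumes "j < length p" "length p \<ge> 4"
  defines "n \<equiv> length p"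
  shows "rotate (j + n - 1) p =
    p ! ((j + n - 1) mod n) # p ! j # p ! ((j + 1) mod n) # map (\<lambda>i. p ! ((j + i) mod n)) [2..<n - 1]"
    (is "_ = ?R")
proof (rule nth_equalityI)
  show "length (rotate (j + n - 1) p) = length ?R" using assms by simp
  fix i assume i: "i < length (rotate (j + n - 1) p)"
  then have i: "i < n" by (simp add: n_def)
  have l: "rotate (j + n - 1) p ! i = p ! ((j + n - 1 + i) mod n)"
    using i by (simp add: nth_rotate n_def)
  consider "i = 0" | "i = 1" | "i = 2" | k where "i = k + 3"
    by (metis One_nat_def add.commute less_2_cases not_less le_Suc_ex numeral_3_eq_3 Suc_leI le_neq_implies_less numeral_2_eq_2)
  then show "rotate (j + n - 1) p ! i = ?R ! i"
  proof cases
    case 2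
    have "j + n - 1 + 1 = j + n" using assms by simp
    then have "(j + n - 1 + 1) mod n = j" using assms by (metis mod_add_self2 mod_less)
    then show ?thesis unfolding l using 2 by simp
  next
    case 3
    have "j + n - 1 + 2 = j + 1 + n" using assms by simp
    then have "(j + n - 1 + 2) mod n = (j + 1) mod n" by (metis mod_add_self2)
    then show ?thesis unfolding l using 3 by simp
  next
    case (4 k)
    have "j + n - 1 + i = j + (k + 2) + n" using assms 4 by simp
    then have "(j + n - 1 + i) mod n = (j + (k + 2)) mod n" by (metis mod_add_self2)
    moreover have "?R ! i = p ! ((j + (2 + k)) mod n)" using 4 i nth_upt[of 2 k "n - 1"] by (simp add: numeral_3_eq_3)
    ultimately show ?thesis unfolding l by (simp add: add.commute)
  qed (use l in simp)
qed

lemma closes_up_collapse: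
  assumes "collapses_to p q"
  shows "closes_up p \<longleftrightarrow> closes_up q" "even (length q)" "length q < length p" "length q \<ge> 2"
proof -
  define n where "n = length p"
  obtain j where j: "j < n" "p ! j = 0" "q = e_collapse p j" and n: "n \<ge> 4" "even n"
    using assms by (auto simp: collapses_to_def n_def)
  define a b r where "a = p ! ((j + n - 1) mod n)" and "b = p ! ((j + 1) mod n)"
    and "r = map (\<lambda>i. p ! ((j + i) mod n)) [2..<n - 1]"
  have rot: "rotate (j + n - 1) p = a # 0 # b # r"
    using rotate_to_letter[of j p] j n by (simp add: a_def b_def r_def n_def)
  have q: "q = (a + b) # r"
    using j(3) by (simp add: e_collapse_def Let_def a_def b_def r_def n_def)
  have "closes_up p \<longleftrightarrow> closes_up (a # 0 # b # r)"
    using closes_up_rotate[of "j + n - 1" p] rot by simp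
  also have "\<dots> \<longleftrightarrow> closes_up q"
    unfolding closes_up_def q by (intro bex_cong) (simp_all add: fan_step_around_even)
  finally show "closes_up p \<longleftrightarrow> closes_up q" .
  show "even (length q)" "length q < length p" "length q \<ge> 2" using n by (auto simp: q r_def n_def)
qed

text \<open>An odd letter sends \<open>(u, v)\<close> through \<open>(v, w)\<close> and \<open>(w, u)\<close> back to \<open>(u, v)\<close>.\<close>

lemma fold_fan_step_odd_letters:
  assumes "s \<in> color_pairs"
  shows "fold fan_step (replicate n 1) s = s \<longleftrightarrow> 3 dvd n"
proof (induction n rule: less_induct)
  case (less n)
  obtain u v where s: "s = (u, v)" "u < 3" "v < 3" "u \<noteq> v" using assms by (auto simp: color_pairs_def)
  note third = third_color[OF s(2-4)]
  consider "n = 0" | "n = 1" | "n = 2" | m where "n = 3 + m"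
    using nat_le_iff_add[of 3 n] by fastforce
  then show ?case
  proof cases
    case 3
    have "\<not> 3 dvd (2::nat)" by simp
    moreover have "fold fan_step (replicate 2 1) s \<noteq> s" using s third by (simp add: numeral_2_eq_2)
    ultimately show ?thesis using 3 by blast
  next
    case (4 m)
    have "fold fan_step (replicate n 1) s = fold fan_step (replicate m 1) s"
      using s third 4 by (simp add: numeral_3_eq_3)
    then show ?thesis using less[of m] 4 by simp
  qed (use s third in auto)
qed

text \<open>Collapse as long as there is an even letter. A sequence without even letters closes up only if its
  length is divisible by 3, hence, being even, by 6; a sequence of length 2 with an even letter closes
  up only if it is \<open>ee\<close>, since one odd letter changes the set of colours in use.\<close>

lemma closes_up_imp_T:
  assumes "closes_up p" "even (length p)" "length p \<ge> 2"
  shows "p \<in> T"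
  using assms
proof (induction "length p" arbitrary: p rule: less_induct)
  case less
  show ?case
  proof (cases "0 \<in> set p")
    case True
    then obtain j where j: "j < length p" "p ! j = 0" by (auto simp: in_set_conv_nth)
    show ?thesis
    proof (cases "length p = 2")
      case True
      then obtain a b where p: "p = [a, b]" by (auto simp: numeral_2_eq_2 length_Suc_conv)
      have "a = 0 \<and> b = 0"
        using less.prems(1) \<open>0 \<in> set p\<close> unfolding p
        by (cases a; cases b) (auto simp: closes_up_def color_pairs_def third_color)
      then show ?thesis using p by (auto simp: T_def)
    next
      case False
      then have "length p \<ge> 4" using less.prems by (cases "length p = 3") auto
      then have c: "collapses_to p (e_collapse p j)" using j less.prems by (auto simp: collapses_to_def)
      then have "e_collapse p j \<in> T"
        using less.hyps closes_up_collapse[OF c] less.prems(1) by blast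
      then show ?thesis using c unfolding T_def by (blast intro: converse_rtranclp_into_rtranclp)
    qed
  next
    case False
    have one: "x = 1" if "x \<in> set p" for x using that False bit_not_zero_iff[of x] by blast
    then have p: "p = replicate (length p) 1" by (intro replicate_eqI) auto
    obtain s where "s \<in> color_pairs" "fold fan_step p s = s"
      using less.prems(1) by (auto simp: closes_up_def)
    then have "3 dvd length p" using fold_fan_step_odd_letters[of s "length p"] p by simp
    then have "6 dvd length p" using less.prems(2) by presburger
    then obtain m where m: "length p = 6 * m" by auto
    then have "m > 0" using less.prems(3) by (cases m) auto
    then show ?thesis using p m unfolding T_def by (metis (mono_tags, lifting) mem_Collect_eq rtranclp.rtrancl_refl)
  qed
qed

lemma T_imp_closes_up:
  assumes "p \<in> T"
  shows "closes_up p"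
proof -
  obtain q where q: "collapses_to\<^sup>*\<^sup>* p q" "q = [0, 0] \<or> (\<exists>m>0. q = replicate (6 * m) 1)"
    using assms by (auto simp: T_def)
  have s: "(0, 1) \<in> color_pairs" by (simp add: color_pairs_def)
  have "closes_up q"
    using q(2)
  proof
    assume "q = [0, 0]"
    then show ?thesis unfolding closes_up_def by (intro bexI[OF _ s]) simp
  next
    assume "\<exists>m>0. q = replicate (6 * m) 1"
    then show ?thesis unfolding closes_up_def
      using fold_fan_step_odd_letters[OF s] s by (metis dvd_triv_left dvd_mult2 dvd_def mult_2_right numeral_Bit0 mult.assoc numeral_times_numeral)
  qed
  with q(1) show ?thesis
    by (induction rule: converse_rtranclp_induct) (auto simp: closes_up_collapse(1))
qed

theorem T_iff_closes_up:
  "even (length p) \<Longrightarrow> length p \<ge> 2 \<Longrightarrow> p \<in> T \<longleftrightarrow> closes_up p"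
  using T_imp_closes_up closes_up_imp_T by blast

section \<open>Cyclic orders of connected 2-regular incidence structures\<close>

lemma card_2_other:
  assumes "card S = 2" "x \<in> S"
  obtains y where "S = {x, y}" "y \<noteq> x"
proof -
  obtain a b where S: "S = {a, b}" "a \<noteq> b" using assms(1) card_2_iff by metis
  then show ?thesis using that[of a] that[of b] assms(2) by (auto simp: insert_commute)
qed

definition partner :: "'a set \<Rightarrow> 'a \<Rightarrow> 'a" where
  "partner S x = (THE y. y \<in> S \<and> y \<noteq> x)"

lemma partner:
  assumes "card S = 2" "x \<in> S"
  shows "partner S x \<in> S" "partner S x \<noteq> x" "partner S (partner S x) = x"
    "y \<in> S \<Longrightarrow> y \<noteq> x \<Longrightarrow> y = partner S x"
proof -
  obtain z where S: "S = {x, z}" "z \<noteq> x" using card_2_other[OF assms] .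
  have "partner S x = z" "partner S z = x"
    unfolding partner_def using S by (auto intro!: the_equality)
  then show "partner S x \<in> S" "partner S x \<noteq> x" "partner S (partner S x) = x"
    "y \<in> S \<Longrightarrow> y \<noteq> x \<Longrightarrow> y = partner S x"
    using S by auto
qed

text \<open>Walk along darts, that is, pairs of a node and an edge at it: \<open>nx\<close> crosses the node to its other
  edge and then that edge to its other node. This is injective on a finite set, so the walk is
  periodic; its nodes are closed under adjacency, hence are all nodes. The point is that no node
  recurs within a period. It could only recur with its two edges exchanged, and \<open>flip\<close>, which
  exchanges them, reverses the walk; moving inwards from both occurrences, the walk would have to turn
  around at a single node or at a single edge.\<close>

lemma two_regular_connected_cyclic_order:
  fixes inc :: "'t \<Rightarrow> 'e \<Rightarrow> bool"
  assumes fin: "finite N" "N \<noteq> {}"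
    and two_e: "\<And>t. t \<in> N \<Longrightarrow> card {e \<in> E. inc t e} = 2"
    and two_t: "\<And>e. e \<in> E \<Longrightarrow> card {t \<in> N. inc t e} = 2"
    and conn: "\<And>C. C \<subseteq> N \<Longrightarrow> C \<noteq> {} \<Longrightarrow>
      (\<And>t t' e. t \<in> C \<Longrightarrow> t' \<in> N \<Longrightarrow> e \<in> E \<Longrightarrow> inc t e \<Longrightarrow> inc t' e \<Longrightarrow> t' \<in> C) \<Longrightarrow> C = N"
  obtains ts where "distinct ts" "set ts = N"
    "\<And>i. i < length ts \<Longrightarrow> \<exists>e\<in>E. inc (ts ! i) e \<and> inc (ts ! (Suc i mod length ts)) e"
proof -
  define across where "across t e = partner {e \<in> E. inc t e} e" for t e
  define over where "over e t = partner {t \<in> N. inc t e} t" for e t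
  define darts where "darts = {(t, e). t \<in> N \<and> e \<in> E \<and> inc t e}"
  define nx where "nx = (\<lambda>(t, e). (over (across t e) t, across t e))"
  define flip where "flip = (\<lambda>(t, e). (t, across t e))"
  have across: "across t e \<in> E" "inc t (across t e)" "across t e \<noteq> e" "across t (across t e) = e"
    "e' \<in> E \<Longrightarrow> inc t e' \<Longrightarrow> e' \<noteq> e \<Longrightarrow> e' = across t e"
    if "(t, e) \<in> darts" for t e e'
  proof -
    have "t \<in> N" and e: "e \<in> {e \<in> E. inc t e}" using that by (auto simp: darts_def)
    note p = partner[OF two_e[OF \<open>t \<in> N\<close>] e, folded across_def]
    show "across t e \<in> E" "inc t (across t e)" using p(1) by simp_all
    show "across t e \<noteq> e" "across t (across t e) = e" using p(2,3) .
    show "e' \<in> E \<Longrightarrow> inc t e' \<Longrightarrow> e' \<noteq> e \<Longrightarrow> e' = across t e" using p(4)[of e'] by simp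
  qed
  have over: "over e t \<in> N" "inc (over e t) e" "over e t \<noteq> t" "over e (over e t) = t"
    "t' \<in> N \<Longrightarrow> inc t' e \<Longrightarrow> t' \<noteq> t \<Longrightarrow> t' = over e t"
    if "(t, e) \<in> darts" for t e t'
  proof -
    have "e \<in> E" and t: "t \<in> {t \<in> N. inc t e}" using that by (auto simp: darts_def)
    note p = partner[OF two_t[OF \<open>e \<in> E\<close>] t, folded over_def]
    show "over e t \<in> N" "inc (over e t) e" using p(1) by simp_all
    show "over e t \<noteq> t" "over e (over e t) = t" using p(2,3) .
    show "t' \<in> N \<Longrightarrow> inc t' e \<Longrightarrow> t' \<noteq> t \<Longrightarrow> t' = over e t" using p(4)[of t'] by simp
  qed
  have flip_dart: "flip d \<in> darts" if "d \<in> darts" for d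
    using that across by (auto simp: flip_def darts_def)
  have nx_dart: "nx d \<in> darts" if d: "d \<in> darts" for d
  proof -
    have "(fst d, across (fst d) (snd d)) \<in> darts" using flip_dart[OF d] by (simp add: flip_def split_beta)
    from over(1,2)[OF this] show ?thesis using across(1)[of "fst d" "snd d"] d
      by (auto simp: nx_def darts_def)
  qed
  have nx_flip: "nx (flip (nx d)) = flip d" if d: "d \<in> darts" for d
  proof -
    obtain t e where te: "d = (t, e)" by (cases d)
    have f: "(t, across t e) \<in> darts" using flip_dart[OF d] te by (simp add: flip_def)
    have n: "(over (across t e) t, across t e) \<in> darts" using nx_dart[OF d] te by (simp add: nx_def)
    show ?thesis using across(4)[OF n] over(4)[OF f] te by (simp add: nx_def flip_def)
  qed
  have inj: "d = d'" if "d \<in> darts" "d' \<in> darts" "nx d = nx d'" for d d'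
  proof -
    have "flip d = flip d'" using nx_flip that by metis
    moreover have "flip (flip d) = d" if "d \<in> darts" for d
      using across(4) that by (auto simp: flip_def split_beta)
    ultimately show ?thesis using that by metis
  qed
  obtain t0 where t0: "t0 \<in> N" using fin by blast
  obtain e0 where e0: "e0 \<in> E" "inc t0 e0"
    using two_e[OF t0] by (metis (mono_tags, lifting) card.empty equals0I mem_Collect_eq zero_neq_numeral)
  define d where "d k = (nx ^^ k) (t0, e0)" for k
  have d0: "(t0, e0) \<in> darts" using t0 e0 by (simp add: darts_def)
  have dd: "d k \<in> darts" for k unfolding d_def by (induction k) (auto simp: d0 nx_dart)
  have dS: "d (Suc k) = nx (d k)" for k by (simp add: d_def)
  have cancel: "d i = d j" if "d (i + k) = d (j + k)" for i j k
    using that by (induction k) (auto simp: dS dest: inj[OF dd dd])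
  have fin_darts: "finite darts"
  proof (rule finite_subset)
    show "darts \<subseteq> (SIGMA t:N. {e \<in> E. inc t e})" by (auto simp: darts_def)
    show "finite (SIGMA t:N. {e \<in> E. inc t e})"
      using fin two_e by (intro finite_SigmaI) (auto intro: card_ge_0_finite)
  qed
  have "\<exists>n>0. d n = d 0"
  proof -
    have "\<not> inj d" using fin_darts dd finite_subset[of "range d" darts] finite_imageD[of d UNIV] by auto
    then obtain i j where ij: "i < j" "d i = d j" by (metis injI linorder_neqE_nat)
    then have "d 0 = d (j - i)" using cancel[of 0 i "j - i"] by simp
    then show ?thesis using ij by (intro exI[of _ "j - i"]) simp
  qed
  define n where "n = (LEAST n. n > 0 \<and> d n = d 0)"
  have n: "n > 0" "d n = d 0" and least: "\<And>m. m > 0 \<Longrightarrow> d m = d 0 \<Longrightarrow> n \<le> m"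
    unfolding n_def using LeastI_ex[OF \<open>\<exists>n>0. d n = d 0\<close>] by (auto intro: Least_le)
  have per: "d (k + n) = d k" for k
    by (induction k) (auto simp: dS n)
  \<comment> \<open>Induction in steps of two: one step inwards from both ends.\<close>
  have no_flip: "d (k + m) \<noteq> flip (d k)" for k m
  proof (induction m arbitrary: k rule: less_induct)
    case (less m)
    obtain t e where te: "d k = (t, e)" by (cases "d k")
    have te_dart: "(t, e) \<in> darts" using dd[of k] te by simp
    consider "m = 0" | "m = 1" | j where "m = Suc (Suc j)" by (metis One_nat_def not0_implies_Suc)
    then show ?case
    proof cases
      case 1
      then show ?thesis using across(3)[OF te_dart] te by (simp add: flip_def)
    next
      case 2
      have "(t, across t e) \<in> darts" using flip_dart[OF te_dart] by (simp add: flip_def)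
      from over(3)[OF this] show ?thesis using 2 te by (simp add: flip_def dS nx_def)
    next
      case (3 j)
      show ?thesis
      proof
        assume "d (k + m) = flip (d k)"
        then have "nx (d (Suc k + j)) = nx (flip (d (Suc k)))" using nx_flip[OF dd] 3 by (simp add: dS)
        then have "d (Suc k + j) = flip (d (Suc k))" by (rule inj[OF dd flip_dart[OF dd]])
        then show False using less[of j "Suc k"] 3 by simp
      qed
    qed
  qed
  define ts where "ts = map (\<lambda>k. fst (d k)) [0..<n]"
  have len: "length ts = n" by (simp add: ts_def)
  have ts_nth: "ts ! k = fst (d k)" if "k < n" for k using that by (simp add: ts_def)
  have neq: "fst (d i) \<noteq> fst (d j)" if "i < j" "j < n" for i j
  proof
    assume eq: "fst (d i) = fst (d j)"
    have "d i \<noteq> d j"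
    proof
      assume "d i = d j"
      then have "d (j - i) = d 0" using cancel[of "j - i" i 0] that by simp
      then show False using least[of "j - i"] that by simp
    qed
    then have "snd (d j) \<noteq> snd (d i)" using eq by (metis prod_eqI)
    then have "snd (d j) = across (fst (d i)) (snd (d i))"
      using across(5)[of "fst (d i)" "snd (d i)" "snd (d j)"] dd[of i] dd[of j] eq
      by (auto simp: darts_def split_beta)
    then have "d j = flip (d i)" using eq by (auto simp: flip_def split_beta prod_eq_iff)
    then show False using no_flip[of i "j - i"] that by simp
  qed
  have dist: "distinct ts"
    unfolding distinct_conv_nth len using ts_nth neq by (metis linorder_neqE_nat)
  have share: "\<exists>e\<in>E. inc (fst (d k)) e \<and> inc (fst (d (Suc k))) e" for k
  proof -
    obtain t e where te: "d k = (t, e)" by (cases "d k")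
    have te_dart: "(t, e) \<in> darts" using dd[of k] te by simp
    have "(t, across t e) \<in> darts" using flip_dart[OF te_dart] by (simp add: flip_def)
    from over(2)[OF this] show ?thesis using across(1,2)[OF te_dart] te
      by (auto simp: dS nx_def)
  qed
  have per_mod: "d (k mod n) = d k" for k
  proof -
    have "d (i + m * n) = d i" for i m
    proof (induction m)
      case (Suc m)
      have "d (i + Suc m * n) = d (i + m * n + n)" by (simp add: algebra_simps)
      then show ?case using Suc per by simp
    qed simp
    then show ?thesis by (metis add.commute mult.commute mult_div_mod_eq)
  qed
  have in_ts: "fst (d k) \<in> set ts" for k
    using per_mod[of k] n(1) by (auto simp: ts_def intro!: image_eqI[of _ _ "k mod n"])
  have "set ts = N"
  proof (rule conn)
    show "set ts \<subseteq> N" using dd by (auto simp: ts_def darts_def split_beta)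
    show "set ts \<noteq> {}" using in_ts by auto
    fix t t' e
    assume a: "t \<in> set ts" "t' \<in> N" "e \<in> E" "inc t e" "inc t' e"
    then obtain k where k: "t = fst (d k)" by (auto simp: ts_def)
    show "t' \<in> set ts"
    proof (cases "t' = t")
      case False
      \<comment> \<open>The predecessor of \<open>k\<close> in the walk, taken one period later so that it exists.\<close>
      define l where "l = k + n - 1"
      have l: "d (Suc l) = d k" using n(1) per[of k] by (simp add: l_def)
      have "(t, e) \<in> darts" using a k dd[of k] by (auto simp: darts_def split_beta)
      then have t': "t' = over e t" using over(5) a False by blast
      have kd: "(t, snd (d k)) \<in> darts" using dd[of k] k by simp
      show ?thesis
      proof (cases "e = snd (d k)")
        case True
        have "t = over e (fst (d l))" "e = across (fst (d l)) (snd (d l))"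
          using arg_cong[OF l, of fst] arg_cong[OF l, of snd] k True by (simp_all add: dS nx_def split_beta)
        moreover have "(fst (d l), across (fst (d l)) (snd (d l))) \<in> darts"
          using flip_dart[OF dd[of l]] by (simp add: flip_def split_beta)
        ultimately have "t' = fst (d l)" using t' over(4) by metis
        then show ?thesis using in_ts by simp
      next
        case False
        then have "e = across t (snd (d k))" using across(5)[OF kd] a by blast
        then have "t' = fst (d (Suc k))" using t' k by (simp add: dS nx_def split_beta)
        then show ?thesis using in_ts by simp
      qed
    qed (use a in simp)
  qed
  moreover have "\<exists>e\<in>E. inc (ts ! i) e \<and> inc (ts ! (Suc i mod length ts)) e" if "i < length ts" for i
  proof -
    have "ts ! (Suc i mod n) = fst (d (Suc i))" using ts_nth[of "Suc i mod n"] n(1) per_mod[of "Suc i"] by simp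
    then show ?thesis using share[of i] ts_nth[of i] that len by simp
  qed
  ultimately show ?thesis using that dist by blast
qed

section \<open>Rings of triangles\<close>

text \<open>Unions of connected components of the dual graph, in which triangles are adjacent when they share
  a cross edge \<open>{a, b}\<close>.\<close>

definition dual_closed :: "'v set \<Rightarrow> 'v set \<Rightarrow> 't set \<Rightarrow> ('t \<Rightarrow> 'v set) \<Rightarrow> 't set \<Rightarrow> bool" where
  "dual_closed A B Tri V C \<longleftrightarrow> C \<subseteq> Tri \<and>
     (\<forall>t\<in>C. \<forall>t'\<in>Tri. \<forall>a\<in>A. \<forall>b\<in>B. {a, b} \<subseteq> V t \<longrightarrow> {a, b} \<subseteq> V t' \<longrightarrow> t' \<in> C)"

lemma dual_closed_subset: "dual_closed A B Tri V C \<Longrightarrow> C \<subseteq> Tri"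
  by (simp add: dual_closed_def)

lemma dual_closedD:
  "dual_closed A B Tri V C \<Longrightarrow> t \<in> C \<Longrightarrow> t' \<in> Tri \<Longrightarrow> a \<in> A \<Longrightarrow> b \<in> B \<Longrightarrow>
    a \<in> V t \<Longrightarrow> b \<in> V t \<Longrightarrow> a \<in> V t' \<Longrightarrow> b \<in> V t' \<Longrightarrow> t' \<in> C"
  unfolding dual_closed_def by blast

lemma dual_closed_swap: "dual_closed A B Tri V C \<Longrightarrow> dual_closed B A Tri V C"
  unfolding dual_closed_def by blast

lemma dual_closed_complement: "dual_closed A B Tri V C \<Longrightarrow> dual_closed A B Tri V (Tri - C)"
  unfolding dual_closed_def by blast

text \<open>The combinatorics of a triangulated ring. \<open>A\<close> and \<open>B\<close> are the vertex sets of the two cycles and \<open>EA\<close>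
  and \<open>EB\<close> their edges; \<open>V t\<close> is the set of vertices of the triangle \<open>t\<close>. That \<open>EA\<close> is one cycle is
  expressed by degree 2 and connectedness. Each triangle has a cycle edge on one side and a single
  vertex on the other. The axioms are symmetric in the two sides, so that each statement about \<open>A\<close> is
  also available for \<open>B\<close> through \<open>swap_sides\<close>.\<close>

locale tri_ring =
  fixes A B :: "'v set" and EA EB :: "'v set set" and Tri :: "'t set" and V :: "'t \<Rightarrow> 'v set"
  assumes finite_sets: "finite A" "finite B" "finite Tri"
    and disjoint: "A \<inter> B = {}"
    and EA_sub: "\<And>e. e \<in> EA \<Longrightarrow> e \<subseteq> A \<and> card e = 2"
    and EB_sub: "\<And>e. e \<in> EB \<Longrightarrow> e \<subseteq> B \<and> card e = 2"
    and EA_ne: "EA \<noteq> {}" and EB_ne: "EB \<noteq> {}"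
    and EA_deg: "\<And>a. a \<in> A \<Longrightarrow> card {e \<in> EA. a \<in> e} = 2"
    and EB_deg: "\<And>b. b \<in> B \<Longrightarrow> card {e \<in> EB. b \<in> e} = 2"
    and EA_conn: "\<And>S. S \<subseteq> EA \<Longrightarrow> S \<noteq> {} \<Longrightarrow>
      (\<And>e e'. e \<in> S \<Longrightarrow> e' \<in> EA \<Longrightarrow> e \<inter> e' \<noteq> {} \<Longrightarrow> e' \<in> S) \<Longrightarrow> S = EA"
    and EB_conn: "\<And>S. S \<subseteq> EB \<Longrightarrow> S \<noteq> {} \<Longrightarrow>
      (\<And>e e'. e \<in> S \<Longrightarrow> e' \<in> EB \<Longrightarrow> e \<inter> e' \<noteq> {} \<Longrightarrow> e' \<in> S) \<Longrightarrow> S = EB"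
    and tri: "\<And>t. t \<in> Tri \<Longrightarrow> V t \<subseteq> A \<union> B \<and>
      (V t \<inter> A \<in> EA \<and> card (V t \<inter> B) = 1 \<or> V t \<inter> B \<in> EB \<and> card (V t \<inter> A) = 1)"
    and EA_tri: "\<And>e. e \<in> EA \<Longrightarrow> \<exists>!t. t \<in> Tri \<and> e \<subseteq> V t"
    and EB_tri: "\<And>e. e \<in> EB \<Longrightarrow> \<exists>!t. t \<in> Tri \<and> e \<subseteq> V t"
    and cross: "\<And>a b t. a \<in> A \<Longrightarrow> b \<in> B \<Longrightarrow> t \<in> Tri \<Longrightarrow> a \<in> V t \<Longrightarrow> b \<in> V t \<Longrightarrow>
      card {t \<in> Tri. a \<in> V t \<and> b \<in> V t} = 2"
begin

lemma swap_sides: "tri_ring B A EB EA Tri V"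
proof
  show "B \<inter> A = {}" using disjoint by blast
  show "V t \<subseteq> B \<union> A \<and>
      (V t \<inter> B \<in> EB \<and> card (V t \<inter> A) = 1 \<or> V t \<inter> A \<in> EA \<and> card (V t \<inter> B) = 1)" if "t \<in> Tri" for t
    using tri[OF that] by blast
  show "card {t \<in> Tri. b \<in> V t \<and> a \<in> V t} = 2"
    if "b \<in> B" "a \<in> A" "t \<in> Tri" "b \<in> V t" "a \<in> V t" for b a t
    using cross[OF that(2,1,3,5,4)] by (simp add: conj_commute)
qed (fact finite_sets EB_sub EA_sub EB_ne EA_ne EB_deg EA_deg EB_conn EA_conn EB_tri EA_tri)+

text \<open>The cycle edge of the triangle lies on the \<open>A\<close> side, so its apex lies in \<open>B\<close>.\<close>

definition on_A :: "'t \<Rightarrow> bool" where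
  "on_A t \<longleftrightarrow> V t \<inter> A \<in> EA"

lemma on_A_cards:
  assumes "t \<in> Tri" "on_A t"
  shows "card (V t \<inter> A) = 2" "card (V t \<inter> B) = 1" "V t \<inter> B \<notin> EB"
  using assms tri[OF assms(1)] EA_sub EB_sub[of "V t \<inter> B"] by (auto simp: on_A_def dest: EA_sub)

lemma not_on_A:
  assumes "t \<in> Tri" "\<not> on_A t"
  shows "V t \<inter> B \<in> EB" "card (V t \<inter> B) = 2" "card (V t \<inter> A) = 1"
  using assms tri[OF assms(1)] EB_sub[of "V t \<inter> B"] by (auto simp: on_A_def)

lemma on_A_swap: "t \<in> Tri \<Longrightarrow> tri_ring.on_A B EB V t \<longleftrightarrow> \<not> on_A t"
  using on_A_cards(3)[of t] not_on_A(1)[of t] tri_ring.on_A_def[OF swap_sides] by blast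

lemma edge_in_triangle:
  assumes "e \<in> EA" "t \<in> Tri" "e \<subseteq> V t"
  shows "on_A t" "V t \<inter> A = e"
proof -
  have e: "e \<subseteq> V t \<inter> A" "card e = 2" using EA_sub[OF assms(1)] assms(3) by auto
  have f: "finite (V t \<inter> A)" using finite_sets by auto
  have "card (V t \<inter> A) \<noteq> 1" using card_mono[OF f e(1)] e(2) by simp
  then show "on_A t" using not_on_A(3)[OF assms(2)] by blast
  then have "card (V t \<inter> A) = card e" using on_A_cards(1)[OF assms(2)] e by simp
  then show "V t \<inter> A = e" using card_subset_eq[OF f e(1)] by simp
qed

text \<open>The two edges of the cycle \<open>A\<close> at \<open>a\<close> correspond to these triangles.\<close>

lemma card_A_triangles_at:
  assumes "a \<in> A"
  shows "card {t \<in> Tri. on_A t \<and> a \<in> V t} = 2"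
proof -
  have "bij_betw (\<lambda>t. V t \<inter> A) {t \<in> Tri. on_A t \<and> a \<in> V t} {e \<in> EA. a \<in> e}"
  proof (rule bij_betwI')
    fix t t' assume t: "t \<in> {t \<in> Tri. on_A t \<and> a \<in> V t}" "t' \<in> {t \<in> Tri. on_A t \<and> a \<in> V t}"
    show "V t \<inter> A = V t' \<inter> A \<longleftrightarrow> t = t'"
    proof
      assume eq: "V t \<inter> A = V t' \<inter> A"
      have "V t \<inter> A \<in> EA" using t by (simp add: on_A_def)
      moreover have "V t \<inter> A \<subseteq> V t" "V t \<inter> A \<subseteq> V t'" using eq by auto
      ultimately show "t = t'" using EA_tri t by blast
    qed simp
  next
    fix e assume "e \<in> {e \<in> EA. a \<in> e}"
    then show "\<exists>t\<in>{t \<in> Tri. on_A t \<and> a \<in> V t}. e = V t \<inter> A"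
      using EA_tri[of e] edge_in_triangle[of e] by blast
  qed (use assms in \<open>auto simp: on_A_def\<close>)
  from bij_betw_same_card[OF this] show ?thesis using EA_deg[OF assms] by simp
qed

text \<open>Count incidences between the triangles of \<open>C\<close> at \<open>a\<close> and the cross edges at \<open>a\<close>. Each cross edge
  counts 0 or 2, as both or none of its triangles belong to \<open>C\<close>. Each triangle counts 2 if its apex is
  \<open>a\<close>, and 1 if it has a cycle edge at \<open>a\<close>.\<close>

lemma closed_meets_A_triangles_at_evenly:
  assumes C: "dual_closed A B Tri V C" and a: "a \<in> A"
  shows "even (card {t \<in> C. on_A t \<and> a \<in> V t})"
proof -
  define Ca where "Ca = {t \<in> C. a \<in> V t}"
  note sub = dual_closed_subset[OF C]
  then have fin: "finite C" using finite_sets(3) finite_subset by blast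
  then have finCa: "finite Ca" by (simp add: Ca_def)
  have "(\<Sum>t\<in>Ca. card (V t \<inter> B)) = (\<Sum>t\<in>Ca. card {b \<in> B. b \<in> V t})"
    by (intro sum.cong refl arg_cong[of _ _ card]) auto
  also have "\<dots> = (\<Sum>b\<in>B. card {t \<in> Ca. b \<in> V t})"
    by (rule sum_multicount_gen[OF finCa finite_sets(2)]) simp
  also have "even \<dots>"
  proof (rule dvd_sum)
    fix b assume b: "b \<in> B"
    show "even (card {t \<in> Ca. b \<in> V t})"
    proof (cases "{t \<in> Ca. b \<in> V t} = {}")
      case False
      then obtain t where t: "t \<in> C" "a \<in> V t" "b \<in> V t" by (auto simp: Ca_def)
      then have "{t \<in> Ca. b \<in> V t} = {t \<in> Tri. a \<in> V t \<and> b \<in> V t}"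
        using dual_closedD[OF C t(1) _ a b t(2,3)] sub by (auto simp: Ca_def)
      then show ?thesis using cross[OF a b, of t] t sub by auto
    qed (simp only: card.empty even_zero)
  qed
  finally have even: "even (\<Sum>t\<in>Ca. card (V t \<inter> B))" .
  have "(\<Sum>t\<in>Ca. card (V t \<inter> B)) = (\<Sum>t\<in>Ca. if on_A t then 1 else 2)"
    using on_A_cards(2) not_on_A(2) sub by (intro sum.cong) (auto simp: Ca_def)
  also have "\<dots> = (\<Sum>t\<in>{t\<in>Ca. on_A t}. 1) + (\<Sum>t\<in>{t\<in>Ca. \<not> on_A t}. 2)"
    using finCa by (simp add: sum.If_cases Int_def)
  also have "\<dots> = card {t \<in> Ca. on_A t} + 2 * card {t\<in>Ca. \<not> on_A t}" by simp
  finally have "even (card {t \<in> Ca. on_A t})" using even by simp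
  moreover have "{t \<in> Ca. on_A t} = {t \<in> C. on_A t \<and> a \<in> V t}" by (auto simp: Ca_def)
  ultimately show ?thesis by simp
qed

text \<open>At each vertex of \<open>A\<close> there are two triangles with a cycle edge there, and \<open>C\<close> contains an even
  number of them; so membership in \<open>C\<close> passes from each edge of the cycle to the next.\<close>

lemma closed_contains_all_A_triangles:
  assumes C: "dual_closed A B Tri V C" and t: "t \<in> C" "on_A t" and t': "t' \<in> Tri" "on_A t'"
  shows "t' \<in> C"
proof -
  note C_sub = dual_closed_subset[OF C]
  define S where "S = {e \<in> EA. \<exists>t\<in>C. e \<subseteq> V t}"
  have "S = EA"
  proof (rule EA_conn)
    show "S \<subseteq> EA" by (auto simp: S_def)
    show "S \<noteq> {}" using t by (auto simp: S_def on_A_def)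
    fix e e' assume e: "e \<in> S" "e' \<in> EA" "e \<inter> e' \<noteq> {}"
    then obtain a where a: "a \<in> e" "a \<in> e'" by blast
    have aA: "a \<in> A" using a(2) EA_sub[OF e(2)] by auto
    obtain s where s: "s \<in> C" "e \<subseteq> V s" "e \<in> EA" using e(1) by (auto simp: S_def)
    obtain s' where s': "s' \<in> Tri" "e' \<subseteq> V s'" using EA_tri[OF e(2)] by blast
    let ?Ta = "{t \<in> Tri. on_A t \<and> a \<in> V t}" and ?Ca = "{t \<in> C. on_A t \<and> a \<in> V t}"
    have sub: "?Ca \<subseteq> ?Ta" using C_sub by auto
    have fT: "finite ?Ta" using finite_sets by auto
    have "s \<in> ?Ca" using s a edge_in_triangle(1)[OF s(3) _ s(2)] C_sub by auto
    then have "card ?Ca > 0" using finite_subset[OF sub fT] card_gt_0_iff by blast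
    moreover have "even (card ?Ca)" using closed_meets_A_triangles_at_evenly[OF C aA] .
    moreover have "card ?Ca \<le> 2" using card_mono[OF fT sub] card_A_triangles_at[OF aA] by simp
    ultimately have "card ?Ca = 2" by (cases "card ?Ca = 1") auto
    then have "?Ca = ?Ta" using card_subset_eq[OF fT sub] card_A_triangles_at[OF aA] by simp
    moreover have "s' \<in> ?Ta" using s' a edge_in_triangle(1)[OF e(2) s'] by auto
    ultimately have "s' \<in> C" by blast
    then show "e' \<in> S" using s' e by (auto simp: S_def)
  qed
  then have "V t' \<inter> A \<in> S" using t' by (simp add: on_A_def)
  then obtain s where s: "s \<in> C" "V t' \<inter> A \<subseteq> V s" by (auto simp: S_def)
  have "V t' \<inter> A \<in> EA" using t' by (simp add: on_A_def)
  then have "s = t'" using EA_tri[of "V t' \<inter> A"] s t' C_sub by blast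
  then show ?thesis using s by simp
qed

text \<open>If no cross edge separates a triangle on \<open>A\<close> from one on \<open>B\<close>, then at a vertex of \<open>A\<close> the two
  triangles at a cross edge are the two triangles with a cycle edge there. So consecutive triangles
  along \<open>A\<close> have the same apex.\<close>

lemma A_triangles_closed_imp_common_apex:
  assumes closed: "dual_closed A B Tri V {t \<in> Tri. on_A t}"
  obtains b where "b \<in> B" "\<And>t. t \<in> Tri \<Longrightarrow> on_A t \<Longrightarrow> b \<in> V t"
proof -
  obtain e0 where e0: "e0 \<in> EA" using EA_ne by blast
  obtain t0 where t0: "t0 \<in> Tri" "e0 \<subseteq> V t0" using EA_tri[OF e0] by blast
  have "card (V t0 \<inter> B) = 1" using on_A_cards(2)[OF t0(1) edge_in_triangle(1)[OF e0 t0]] .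
  then obtain b where b: "b \<in> B" "b \<in> V t0" by (metis Int_iff card_1_singletonE insertI1)
  define S where "S = {e \<in> EA. \<exists>t\<in>Tri. e \<subseteq> V t \<and> b \<in> V t}"
  have "S = EA"
  proof (rule EA_conn)
    show "S \<subseteq> EA" by (auto simp: S_def)
    show "S \<noteq> {}" using t0 e0 b by (auto simp: S_def)
    fix e e' assume e: "e \<in> S" "e' \<in> EA" "e \<inter> e' \<noteq> {}"
    then obtain a where a: "a \<in> e" "a \<in> e'" by blast
    have aA: "a \<in> A" using a(2) EA_sub[OF e(2)] by auto
    obtain s where s: "s \<in> Tri" "e \<subseteq> V s" "e \<in> EA" "b \<in> V s" using e(1) by (auto simp: S_def)
    obtain s' where s': "s' \<in> Tri" "e' \<subseteq> V s'" using EA_tri[OF e(2)] by blast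
    have sA: "on_A s" "on_A s'" using edge_in_triangle(1) s s' e(2) by blast+
    let ?Ta = "{t \<in> Tri. on_A t \<and> a \<in> V t}" and ?Tab = "{t \<in> Tri. a \<in> V t \<and> b \<in> V t}"
    have "?Tab \<subseteq> ?Ta" using dual_closedD[OF closed _ _ aA b(1), of s] sA a s by auto
    moreover have "card ?Tab = 2" using cross[OF aA b(1) s(1)] a s by auto
    ultimately have "?Tab = ?Ta"
      using card_A_triangles_at[OF aA] card_subset_eq[of ?Ta ?Tab] finite_sets(3) by simp
    moreover have "s' \<in> ?Ta" using s' sA a by auto
    ultimately show "e' \<in> S" using s' e by (auto simp: S_def)
  qed
  show ?thesis
  proof (rule that[OF b(1)])
    fix t assume t: "t \<in> Tri" "on_A t"
    then have "V t \<inter> A \<in> S" using \<open>S = EA\<close> by (simp add: on_A_def)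
    then obtain s where s: "s \<in> Tri" "V t \<inter> A \<subseteq> V s" "b \<in> V s" by (auto simp: S_def)
    have "V t \<inter> A \<in> EA" using t by (simp add: on_A_def)
    then have "s = t" using EA_tri[of "V t \<inter> A"] s t by blast
    then show "b \<in> V t" using s by simp
  qed
qed

lemma ex_A_triangle_at:
  assumes "a \<in> A"
  obtains t where "t \<in> Tri" "on_A t" "a \<in> V t"
proof -
  have "{t \<in> Tri. on_A t \<and> a \<in> V t} \<noteq> {}"
    using card_A_triangles_at[OF assms] by (metis card.empty zero_neq_numeral)
  then show ?thesis using that by blast
qed

text \<open>A proper union of components consists of all triangles on \<open>A\<close> or of all triangles on \<open>B\<close>, so both
  families are closed. Then all triangles on \<open>A\<close> share an apex \<open>b\<close> and all triangles on \<open>B\<close> share an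
  apex \<open>a\<close>, and the edge \<open>{a, b}\<close> is a cross edge of triangles of both families.\<close>

lemma dual_connected:
  assumes C: "dual_closed A B Tri V C" "C \<noteq> {}"
  shows "C = Tri"
proof (rule ccontr)
  interpret swap: tri_ring B A EB EA Tri V by (rule swap_sides)
  assume "C \<noteq> Tri"
  note sub = dual_closed_subset[OF C(1)]
  then obtain s where s: "s \<in> Tri" "s \<notin> C" using \<open>C \<noteq> Tri\<close> by blast
  obtain r where r: "r \<in> C" using C(2) by blast
  have allA: "t' \<in> C" if "t \<in> C" "on_A t" "t' \<in> Tri" "on_A t'" for t t'
    using closed_contains_all_A_triangles[OF C(1) that] .
  have allB: "t' \<in> C" if "t \<in> C" "\<not> on_A t" "t' \<in> Tri" "\<not> on_A t'" for t t'
    using swap.closed_contains_all_A_triangles[OF dual_closed_swap[OF C(1)], of t t'] that on_A_swap sub by blast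
  have "C = {t \<in> Tri. on_A t} \<or> C = {t \<in> Tri. \<not> on_A t}"
    using allA[OF r] allB[OF r] allA[of _ s] allB[of _ s] s sub r by blast
  moreover have "Tri - {t \<in> Tri. on_A t} = {t \<in> Tri. \<not> on_A t}" "Tri - {t \<in> Tri. \<not> on_A t} = {t \<in> Tri. on_A t}"
    by blast+
  ultimately have closed: "dual_closed A B Tri V {t \<in> Tri. on_A t}" "dual_closed A B Tri V {t \<in> Tri. \<not> on_A t}"
    using C(1) dual_closed_complement[OF C(1)] by metis+
  have "{t \<in> Tri. \<not> on_A t} = {t \<in> Tri. swap.on_A t}" using on_A_swap by blast
  then have closed': "dual_closed B A Tri V {t \<in> Tri. swap.on_A t}"
    using dual_closed_swap[OF closed(2)] by simp
  obtain b where b: "b \<in> B" "\<And>t. t \<in> Tri \<Longrightarrow> on_A t \<Longrightarrow> b \<in> V t"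
    using A_triangles_closed_imp_common_apex[OF closed(1)] by blast
  obtain a where a: "a \<in> A" "\<And>t. t \<in> Tri \<Longrightarrow> swap.on_A t \<Longrightarrow> a \<in> V t"
    using swap.A_triangles_closed_imp_common_apex[OF closed'] by blast
  obtain t where t: "t \<in> Tri" "on_A t" "a \<in> V t" using ex_A_triangle_at[OF a(1)] .
  obtain u where u: "u \<in> Tri" "swap.on_A u" "b \<in> V u" using swap.ex_A_triangle_at[OF b(1)] .
  have "u \<in> {t \<in> Tri. on_A t}"
    using dual_closedD[OF closed(1) _ u(1) a(1) b(1) t(3) b(2)[OF t(1,2)] a(2)[OF u(1,2)] u(3)] t by simp
  then show False using on_A_swap[OF u(1)] u(2) by simp
qed

lemma cyclic_order_exists:
  obtains ts where "distinct ts" "set ts = Tri"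
    "\<And>i. i < length ts \<Longrightarrow> \<exists>a\<in>A. \<exists>b\<in>B. {a, b} \<subseteq> V (ts ! i) \<and> {a, b} \<subseteq> V (ts ! (Suc i mod length ts))"
proof -
  define X where "X = {(a, b). a \<in> A \<and> b \<in> B \<and> (\<exists>t\<in>Tri. a \<in> V t \<and> b \<in> V t)}"
  define inc where "inc t e \<longleftrightarrow> fst e \<in> V t \<and> snd e \<in> V t" for t and e :: "'v \<times> 'v"
  have two_e: "card {e \<in> X. inc t e} = 2" if t: "t \<in> Tri" for t
  proof -
    have "{e \<in> X. inc t e} = (V t \<inter> A) \<times> (V t \<inter> B)" using t by (auto simp: X_def inc_def)
    then show ?thesis using on_A_cards[OF t] not_on_A[OF t] by (cases "on_A t") (auto simp: card_cartesian_product)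
  qed
  have two_t: "card {t \<in> Tri. inc t e} = 2" if "e \<in> X" for e
    using that cross by (auto simp: X_def inc_def)
  have ne: "Tri \<noteq> {}" using EA_ne EA_tri by blast
  have conn: "C = Tri" if "C \<subseteq> Tri" "C \<noteq> {}"
    "\<And>t t' e. t \<in> C \<Longrightarrow> t' \<in> Tri \<Longrightarrow> e \<in> X \<Longrightarrow> inc t e \<Longrightarrow> inc t' e \<Longrightarrow> t' \<in> C" for C
  proof (rule dual_connected[OF _ that(2)])
    have "t' \<in> C" if "t \<in> C" "t' \<in> Tri" "a \<in> A" "b \<in> B" "{a, b} \<subseteq> V t" "{a, b} \<subseteq> V t'" for t t' a b
      using \<open>\<And>t t' e. t \<in> C \<Longrightarrow> t' \<in> Tri \<Longrightarrow> e \<in> X \<Longrightarrow> inc t e \<Longrightarrow> inc t' e \<Longrightarrow> t' \<in> C\<close>[of t t' "(a, b)"]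
        that \<open>C \<subseteq> Tri\<close> by (auto simp: X_def inc_def)
    then show "dual_closed A B Tri V C" using \<open>C \<subseteq> Tri\<close> unfolding dual_closed_def by blast
  qed
  obtain ts where ts: "distinct ts" "set ts = Tri"
    "\<And>i. i < length ts \<Longrightarrow> \<exists>e\<in>X. inc (ts ! i) e \<and> inc (ts ! (Suc i mod length ts)) e"
    by (rule two_regular_connected_cyclic_order[OF finite_sets(3) ne two_e two_t conn]) auto
  have "\<exists>a\<in>A. \<exists>b\<in>B. {a, b} \<subseteq> V (ts ! i) \<and> {a, b} \<subseteq> V (ts ! (Suc i mod length ts))"
    if "i < length ts" for i
    using ts(3)[OF that] by (auto simp: X_def inc_def)
  then show ?thesis using that ts by blast
qed

text \<open>Two triangles with a cycle edge at a vertex of \<open>A\<close>, and one on the other side. With at least three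
  triangles in cyclic order, three consecutive ones are distinct.\<close>

lemma card_Tri: "card Tri \<ge> 3"
proof -
  interpret swap: tri_ring B A EB EA Tri V by (rule swap_sides)
  obtain e where e: "e \<in> EA" using EA_ne by blast
  then have "e \<noteq> {}" "e \<subseteq> A" using EA_sub[OF e] by auto
  then obtain a where a: "a \<in> A" by blast
  obtain e' where e': "e' \<in> EB" using EB_ne by blast
  then have "e' \<noteq> {}" "e' \<subseteq> B" using EB_sub[OF e'] by auto
  then obtain b where b: "b \<in> B" by blast
  obtain t where t: "t \<in> Tri" "\<not> on_A t" using swap.ex_A_triangle_at[OF b] on_A_swap by metis
  have "card (insert t {t \<in> Tri. on_A t \<and> a \<in> V t}) = 3"
    using card_A_triangles_at[OF a] t finite_sets by simp
  moreover have "insert t {t \<in> Tri. on_A t \<and> a \<in> V t} \<subseteq> Tri" using t by auto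
  ultimately show ?thesis using card_mono[OF finite_sets(3)] by metis
qed

end

section \<open>Colouring along a walk around the ring\<close>

lemma exit_step:
  assumes "k \<le> i" "f k = v" "f i \<noteq> v"
  obtains s where "k \<le> s" "s < i" "f s = v" "f (Suc s) \<noteq> (v::'a)"
  using assms(1,3)
proof (induction "i" arbitrary: thesis rule: dec_induct)
  case base
  then show ?case using assms(2) by simp
next
  case (step i)
  show ?case
  proof (cases "f i = v")
    case True
    then show ?thesis using step.prems(1)[of i] step.hyps step.prems(2) by simp
  next
    case False
    then show ?thesis using step.IH step.prems(1) by (metis less_SucI)
  qed
qed

lemma entry_step:
  assumes "i \<le> l" "f l = v" "f i \<noteq> v"
  obtains s where "i \<le> s" "s < l" "f s \<noteq> v" "f (Suc s) = (v::'a)"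
  using assms
proof (induction "l" arbitrary: thesis rule: dec_induct)
  case (step l)
  show ?case
  proof (cases "f l = v")
    case True
    then show ?thesis using step.IH step.prems by (metis less_SucI)
  next
    case False
    then show ?thesis using step.prems(1)[of l] step.hyps step.prems(2) by simp
  qed
qed simp

text \<open>The effect of crossing one triangle on the colours of the current cross edge. The flag says on which
  side the triangle has its cycle edge, that is, which end of the cross edge moves on.\<close>

definition tri_step :: "bool \<Rightarrow> nat \<times> nat \<Rightarrow> nat \<times> nat" where
  "tri_step h s = (if h then (third (fst s) (snd s), snd s) else (fst s, third (fst s) (snd s)))"

lemma tri_step_in_color_pairs: "s \<in> color_pairs \<Longrightarrow> tri_step h s \<in> color_pairs"
proof -
  assume "s \<in> color_pairs"
  then obtain u v where s: "s = (u, v)" "u < 3" "v < 3" "u \<noteq> v" by (auto simp: color_pairs_def)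
  show ?thesis using s third_color(1,2,3)[OF s(2-4)] by (auto simp: color_pairs_def tri_step_def)
qed

lemma fold_map_upt:
  assumes "\<And>k. S (Suc k) = f (g k) (S k)"
  shows "fold f (map g [0..<n]) (S 0) = S n"
  by (induction n) (simp_all add: assms)

text \<open>A closed walk through all triangles, made periodic in order to avoid indices modulo \<open>N\<close>: the triangle
  \<open>t k\<close> is entered through the cross edge \<open>{x k, y k}\<close> and left through \<open>{x (k + 1), y (k + 1)}\<close>.\<close>

locale ring_walk = tri_ring A B EA EB Tri V
  for A B :: "'v set" and EA EB and Tri :: "'t set" and V +
  fixes t :: "nat \<Rightarrow> 't" and x y :: "nat \<Rightarrow> 'v" and N :: nat
  assumes t_onto: "t ` {..<N} = Tri"
    and t_inj: "inj_on t {..<N}"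
    and periodic: "\<And>k. t (k + N) = t k" "\<And>k. x (k + N) = x k" "\<And>k. y (k + N) = y k"
    and sides: "\<And>k. x k \<in> A" "\<And>k. y k \<in> B"
    and entry: "\<And>k. x k \<in> V (t k)" "\<And>k. y k \<in> V (t k)"
    and exit: "\<And>k. x (Suc k) \<in> V (t k)" "\<And>k. y (Suc k) \<in> V (t k)"
begin

lemma swap_walk: "ring_walk B A EB EA Tri V t y x N"
  by (intro ring_walk.intro swap_sides ring_walk_axioms.intro)
    (fact t_onto t_inj periodic sides entry exit)+

lemma N_ge: "N \<ge> 3"
  using card_Tri card_image[OF t_inj] t_onto by simp

lemma periodic_mod: "(\<And>k. f (k + N) = f k) \<Longrightarrow> f (k mod N) = f k" for f :: "nat \<Rightarrow> 'a"
proof -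
  assume per: "\<And>k. f (k + N) = f k"
  have "f (i + m * N) = f i" for i m
  proof (induction m)
    case (Suc m)
    have "f (i + Suc m * N) = f (i + m * N + N)" by (simp add: algebra_simps)
    then show ?case using Suc per by simp
  qed simp
  then show ?thesis by (metis add.commute mult.commute mult_div_mod_eq)
qed

lemma t_in: "t k \<in> Tri"
  using periodic_mod[of t k, OF periodic(1)] t_onto N_ge
  by (metis image_eqI lessThan_iff mod_less_divisor not_less_eq_eq numeral_3_eq_3 le0 less_le_trans zero_less_Suc)

lemma t_eq_iff: "t k = t l \<longleftrightarrow> k mod N = l mod N"
proof -
  have "t k = t (k mod N)" "t l = t (l mod N)" using periodic_mod[of t, OF periodic(1)] by simp_all
  moreover have "k mod N < N" "l mod N < N" using N_ge by simp_all
  ultimately show ?thesis using inj_onD[OF t_inj, of "k mod N" "l mod N"] by auto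
qed

lemma t_neq: "k < l \<Longrightarrow> l < k + N \<Longrightarrow> t k \<noteq> t l"
proof
  assume kl: "k < l" "l < k + N" "t k = t l"
  then have "N dvd l - k" using t_eq_iff mod_eq_dvd_iff_nat[of k l N] by (metis less_imp_le_nat)
  then show False using kl by (auto dest: dvd_imp_le)
qed

lemma ex_t: "s \<in> Tri \<Longrightarrow> \<exists>k<N. t k = s"
  using t_onto by auto

text \<open>If the entry and exit edge of a triangle were equal, three consecutive triangles of the walk would
  share one cross edge.\<close>

lemma moves: "x (Suc k) \<noteq> x k \<or> y (Suc k) \<noteq> y k"
proof -
  have *: "x (Suc (Suc k)) \<noteq> x (Suc k) \<or> y (Suc (Suc k)) \<noteq> y (Suc k)" for k
  proof (rule ccontr)
    assume "\<not> ?thesis"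
    then have eq: "x (Suc (Suc k)) = x (Suc k)" "y (Suc (Suc k)) = y (Suc k)" by auto
    let ?S = "{s \<in> Tri. x (Suc k) \<in> V s \<and> y (Suc k) \<in> V s}"
    have "{t k, t (Suc k), t (Suc (Suc k))} \<subseteq> ?S"
      using t_in entry[of "Suc k"] exit[of k] entry[of "Suc (Suc k)"] eq by auto
    moreover have "card {t k, t (Suc k), t (Suc (Suc k))} = 3"
      using t_neq[of k "Suc k"] t_neq[of k "Suc (Suc k)"] t_neq[of "Suc k" "Suc (Suc k)"] N_ge by simp
    moreover have "finite ?S" using finite_sets(3) by simp
    ultimately have "card ?S \<ge> 3" by (metis card_mono)
    then show False using sides t_in entry cross[of "x (Suc k)" "y (Suc k)" "t (Suc k)"] by simp
  qed
  \<comment> \<open>The argument above compares positions from 1 on; position 0 is reached by going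
    one period further.\<close>
  have "Suc (Suc (k + N - 1)) = Suc k + N" "Suc (k + N - 1) = k + N" using N_ge by simp_all
  then show ?thesis using *[of "k + N - 1"] periodic(2,3) by metis
qed

lemma A_step:
  assumes "on_A (t k)"
  shows "y (Suc k) = y k" "V (t k) \<inter> B = {y k}" "x (Suc k) \<noteq> x k" "V (t k) \<inter> A = {x k, x (Suc k)}"
proof -
  obtain b where b: "V (t k) \<inter> B = {b}" using on_A_cards(2)[OF t_in assms] card_1_singletonE by blast
  moreover have "y k \<in> V (t k) \<inter> B" "y (Suc k) \<in> V (t k) \<inter> B"
    using entry(2) exit(2) sides(2) by auto
  ultimately show y: "y (Suc k) = y k" "V (t k) \<inter> B = {y k}" by simp_all
  then show ne: "x (Suc k) \<noteq> x k" using moves[of k] by simp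
  have "{x k, x (Suc k)} \<subseteq> V (t k) \<inter> A" using entry(1) exit(1) sides(1) by simp
  moreover have "card {x k, x (Suc k)} = 2" using ne by simp
  ultimately show "V (t k) \<inter> A = {x k, x (Suc k)}"
    using on_A_cards(1)[OF t_in assms] finite_sets(1)
    by (intro card_subset_eq[symmetric]) simp_all
qed

lemma B_step:
  assumes "\<not> on_A (t k)"
  shows "x (Suc k) = x k" "V (t k) \<inter> A = {x k}" "y (Suc k) \<noteq> y k" "V (t k) \<inter> B = {y k, y (Suc k)}"
  using ring_walk.A_step[OF swap_walk, of k] on_A_swap[OF t_in] assms by simp_all

lemma V_t: "V (t k) = {x k, x (Suc k), y k, y (Suc k)}"
proof -
  have "V (t k) = (V (t k) \<inter> A) \<union> (V (t k) \<inter> B)" using tri[OF t_in[of k]] by blast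
  then show ?thesis using A_step[of k] B_step[of k] by (cases "on_A (t k)") auto
qed

text \<open>A visit to a vertex \<open>v\<close> begins and ends with a triangle that has a cycle edge at \<open>v\<close>, and there are
  only two such triangles. Two separate visits within a period would need at least three: one to leave
  the first visit, one to enter the second, and one to leave the second.\<close>

lemma visits_contiguous:
  assumes "k \<le> l" "l \<le> k + N" "x k = x l"
  shows "(\<forall>i. k \<le> i \<and> i \<le> l \<longrightarrow> x i = x k) \<or> (\<forall>i. l \<le> i \<and> i \<le> k + N \<longrightarrow> x i = x k)"
proof (rule ccontr)
  assume "\<not> ?thesis"
  then obtain i j where i: "k \<le> i" "i \<le> l" "x i \<noteq> x k" and j: "l \<le> j" "j \<le> k + N" "x j \<noteq> x k"
    by blast
  obtain s0 where s0: "k \<le> s0" "s0 < i" "x s0 = x k" "x (Suc s0) \<noteq> x k"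
    using exit_step[OF i(1) refl i(3)] .
  obtain s1 where s1: "i \<le> s1" "s1 < l" "x s1 \<noteq> x k" "x (Suc s1) = x k"
    using entry_step[of i l x "x k"] i(2,3) assms(3) by metis
  obtain s2 where s2: "l \<le> s2" "s2 < j" "x s2 = x k" "x (Suc s2) \<noteq> x k"
    using exit_step[of l j x "x k"] j(1,3) assms(3) by metis
  let ?S = "{s \<in> Tri. on_A s \<and> x k \<in> V s}"
  have A: "on_A (t s)" if "x (Suc s) \<noteq> x s" for s using B_step(1)[of s] that by blast
  have "{t s0, t s1, t s2} \<subseteq> ?S"
    using A[of s0] A[of s1] A[of s2] entry(1)[of s0] exit(1)[of s1] entry(1)[of s2] s0 s1 s2 t_in by auto
  moreover have "card {t s0, t s1, t s2} = 3"
    using t_neq[of s0 s1] t_neq[of s0 s2] t_neq[of s1 s2] s0 s1 s2 i j by simp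
  moreover have "finite ?S" using finite_sets(3) by simp
  ultimately have "card ?S \<ge> 3" by (metis card_mono)
  then show False using card_A_triangles_at[OF sides(1)[of k]] by simp
qed

text \<open>This makes labels of walk positions into labels of vertices.\<close>

lemma const_along_visits:
  fixes c :: "nat \<Rightarrow> 'c"
  assumes per: "\<And>k. c (k + N) = c k" and stay: "\<And>k. x (Suc k) = x k \<Longrightarrow> c (Suc k) = c k"
    and eq: "x k = x l"
  shows "c k = c l"
proof -
  have const: "c i = c j" if "i \<le> j" "\<forall>m. i \<le> m \<and> m \<le> j \<longrightarrow> x m = x i" for i j
    using that
  proof (induction j rule: dec_induct)
    case (step j)
    have "x j = x i" "x (Suc j) = x i"
      using step.prems[rule_format, of j] step.prems[rule_format, of "Suc j"] step.hyps by linarith+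
    then have "c (Suc j) = c j" using stay[of j] by metis
    moreover have "c i = c j" using step.IH step.prems le_SucI by blast
    ultimately show ?case by simp
  qed simp
  have *: "c i = c j" if "i \<le> j" "j < N" "x i = x j" for i j
  proof -
    have "j \<le> i + N" using that(2) by simp
    from visits_contiguous[OF that(1) this that(3)] show ?thesis
    proof
      assume "\<forall>m. i \<le> m \<and> m \<le> j \<longrightarrow> x m = x i"
      then show ?thesis using const[OF that(1)] by blast
    next
      assume "\<forall>m. j \<le> m \<and> m \<le> i + N \<longrightarrow> x m = x i"
      then have "c j = c (i + N)" using const[OF \<open>j \<le> i + N\<close>] unfolding that(3) by blast
      then show ?thesis using per by simp
    qed
  qed
  have "x (k mod N) = x (l mod N)" using eq periodic_mod[of x, OF periodic(2)] by simp
  moreover have "k mod N < N" "l mod N < N" using N_ge by simp_all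
  ultimately have "c (k mod N) = c (l mod N)" using * by (metis nat_le_linear)
  then show ?thesis using periodic_mod[of c, OF per] by simp
qed

text \<open>Requiring a colouring to be injective on each triangle covers every edge. Around a triangle the new
  vertex has no choice but the third colour, so a colouring is the same as a pair that returns to
  itself.\<close>

theorem proper_coloring_iff_fixed_pair:
  "(\<exists>col :: 'v \<Rightarrow> nat. (\<forall>v\<in>A \<union> B. col v < 3) \<and> (\<forall>s\<in>Tri. inj_on col (V s))) \<longleftrightarrow>
   (\<exists>s\<in>color_pairs. fold tri_step (map (\<lambda>k. on_A (t k)) [0..<N]) s = s)"
proof
  assume "\<exists>col :: 'v \<Rightarrow> nat. (\<forall>v\<in>A \<union> B. col v < 3) \<and> (\<forall>s\<in>Tri. inj_on col (V s))"
  then obtain col :: "'v \<Rightarrow> nat" where lt: "\<And>v. v \<in> A \<union> B \<Longrightarrow> col v < 3"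
    and inj: "\<And>s. s \<in> Tri \<Longrightarrow> inj_on col (V s)" by blast
  define S where "S k = (col (x k), col (y k))" for k
  have lt': "col (x k) < 3" "col (y k) < 3" for k using lt sides by blast+
  have xy: "x k \<noteq> y l" for k l
    using sides(1)[of k] sides(2)[of l] disjoint by (metis IntI empty_iff)
  have ne: "col u \<noteq> col v" if "u \<in> V (t k)" "v \<in> V (t k)" "u \<noteq> v" for u v k
    using inj_onD[OF inj[OF t_in]] that by blast
  have step: "S (Suc k) = tri_step (on_A (t k)) (S k)" for k
  proof (cases "on_A (t k)")
    case True
    have "col (x (Suc k)) = third (col (x k)) (col (y k))"
      using ne[OF entry[of k] xy] ne[OF exit(1) entry(1) A_step(3)[OF True]] ne[OF exit(1) entry(2) xy] lt'
      by (intro third_unique) auto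
    then show ?thesis using True A_step(1)[OF True] by (simp add: S_def tri_step_def)
  next
    case False
    have "col (y (Suc k)) = third (col (x k)) (col (y k))"
      using ne[OF entry[of k] xy] ne[OF exit(2) entry(2) B_step(3)[OF False]]
        ne[OF exit(2) entry(1) xy[symmetric]] lt'
      by (intro third_unique) auto
    then show ?thesis using False B_step(1)[OF False] by (simp add: S_def tri_step_def)
  qed
  have "S 0 \<in> color_pairs" using ne[OF entry[of 0] xy] lt' by (simp add: S_def color_pairs_def)
  moreover have "fold tri_step (map (\<lambda>k. on_A (t k)) [0..<N]) (S 0) = S N"
    using step by (rule fold_map_upt)
  moreover have "S N = S 0" using periodic(2,3)[of 0] by (simp add: S_def)
  ultimately show "\<exists>s\<in>color_pairs. fold tri_step (map (\<lambda>k. on_A (t k)) [0..<N]) s = s" by metis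
next
  interpret swap: ring_walk B A EB EA Tri V t y x N by (rule swap_walk)
  assume "\<exists>s\<in>color_pairs. fold tri_step (map (\<lambda>k. on_A (t k)) [0..<N]) s = s"
  then obtain s where s: "s \<in> color_pairs" "fold tri_step (map (\<lambda>k. on_A (t k)) [0..<N]) s = s"
    by blast
  \<comment> \<open>Conversely, the states are developed from the fixed pair along the walk.\<close>
  define S where "S = rec_nat s (\<lambda>k. tri_step (on_A (t k)))"
  have S: "S 0 = s" "S (Suc k) = tri_step (on_A (t k)) (S k)" for k by (simp_all add: S_def)
  have "S N = S 0" using fold_map_upt[of S tri_step "\<lambda>k. on_A (t k)" N] S s(2) by simp
  then have per: "S (k + N) = S k" for k
    by (induction k) (simp_all add: S(2) periodic(1))
  have valid: "S k \<in> color_pairs" for k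
    by (induction k) (simp_all add: S s(1) tri_step_in_color_pairs)
  define cx cy where "cx k = fst (S k)" and "cy k = snd (S k)" for k
  have pair: "cx k < 3" "cy k < 3" "cx k \<noteq> cy k" for k
    using valid[of k] by (auto simp: cx_def cy_def color_pairs_def split_beta)
  have stepA: "cx (Suc k) = third (cx k) (cy k)" "cy (Suc k) = cy k" if "on_A (t k)" for k
    using that by (simp_all add: cx_def cy_def S(2) tri_step_def)
  have stepB: "cy (Suc k) = third (cx k) (cy k)" "cx (Suc k) = cx k" if "\<not> on_A (t k)" for k
    using that by (simp_all add: cx_def cy_def S(2) tri_step_def)
  define col where "col v = (if v \<in> A then cx (SOME k. x k = v) else cy (SOME k. y k = v))" for v
  have col_x: "col (x k) = cx k" for k
  proof -
    have "x (SOME l. x l = x k) = x k" by (rule someI) simp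
    then have "cx (SOME l. x l = x k) = cx k"
    proof (rule const_along_visits[rotated 2])
      show "cx (k + N) = cx k" for k using per by (simp add: cx_def)
      show "cx (Suc k) = cx k" if "x (Suc k) = x k" for k using that A_step(3) stepB(2) by blast
    qed
    then show ?thesis using sides(1)[of k] by (simp add: col_def)
  qed
  have col_y: "col (y k) = cy k" for k
  proof -
    have "y (SOME l. y l = y k) = y k" by (rule someI) simp
    then have "cy (SOME l. y l = y k) = cy k"
    proof (rule swap.const_along_visits[rotated 2])
      show "cy (k + N) = cy k" for k using per by (simp add: cy_def)
      show "cy (Suc k) = cy k" if "y (Suc k) = y k" for k using that B_step(3) stepA(2) by blast
    qed
    then show ?thesis using sides(2)[of k] disjoint by (auto simp: col_def)
  qed
  have "inj_on col (V u)" if u: "u \<in> Tri" for u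
  proof -
    obtain k where k: "t k = u" using ex_t[OF u] by blast
    note third = third_color(2,3)[OF pair[of k]]
    show ?thesis
    proof (cases "on_A (t k)")
      case True
      then have "V u = {x k, x (Suc k), y k}" using V_t[of k] A_step(1)[OF True] k by auto
      moreover have "col (x k) \<noteq> col (x (Suc k))" "col (x k) \<noteq> col (y k)" "col (x (Suc k)) \<noteq> col (y k)"
        unfolding col_x col_y stepA[OF True] using third pair(3)[of k] by (simp_all add: eq_commute)
      ultimately show ?thesis by (auto simp: inj_on_def)
    next
      case False
      then have "V u = {x k, y k, y (Suc k)}" using V_t[of k] B_step(1)[OF False] k by auto
      moreover have "col (x k) \<noteq> col (y k)" "col (x k) \<noteq> col (y (Suc k))" "col (y k) \<noteq> col (y (Suc k))"
        unfolding col_x col_y stepB[OF False] using third pair(3)[of k] by (simp_all add: eq_commute)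
      ultimately show ?thesis by (auto simp: inj_on_def)
    qed
  qed
  moreover have "col v < 3" for v using pair by (simp add: col_def)
  ultimately show "\<exists>col :: 'v \<Rightarrow> nat. (\<forall>v\<in>A \<union> B. col v < 3) \<and> (\<forall>s\<in>Tri. inj_on col (V s))"
    by blast
qed

end

section \<open>Fans\<close>

text \<open>Translates between a pair ordered along the walk (previous apex, current apex) and a pair ordered by
  sides (\<open>A\<close>, \<open>B\<close>). The flag says that the current fan has its apex in \<open>B\<close>.\<close>

definition orient :: "bool \<Rightarrow> nat \<times> nat \<Rightarrow> nat \<times> nat" where
  "orient h s = (if h then s else (snd s, fst s))"

lemma orient_color_pairs: "orient h s \<in> color_pairs \<longleftrightarrow> s \<in> color_pairs"
  by (cases s) (auto simp: orient_def color_pairs_def)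

lemma orient_orient: "orient h (orient h s) = s"
  by (simp add: orient_def)

text \<open>After \<open>r\<close> triangles with the same apex, the moving end has the old colour or the third one,
  according to the parity of \<open>r\<close>. The next apex is on the other side, so the orientation flips.\<close>

lemma fold_tri_step_fan:
  assumes "s \<in> color_pairs"
  shows "fold tri_step (replicate r h) (orient h s) = orient (\<not> h) (fan_step (of_nat r) s)"
proof (induction r)
  case 0
  then show ?case by (cases s) (simp add: orient_def)
next
  case (Suc r)
  obtain u v where s: "s = (u, v)" "u < 3" "v < 3" "u \<noteq> v" using assms by (auto simp: color_pairs_def)
  note third = third_color[OF s(2-4)]
  have "fold tri_step (replicate (Suc r) h) (orient h s) = tri_step h (fold tri_step (replicate r h) (orient h s))"
    by (simp only: replicate_append_same[symmetric] replicate_Suc fold_append o_apply fold_simps)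
  also have "\<dots> = tri_step h (orient (\<not> h) (fan_step (of_nat r) s))" using Suc by simp
  also have "\<dots> = orient (\<not> h) (fan_step (of_nat r + 1) s)"
    using s third by (cases "(of_nat r :: bit)") (auto simp: tri_step_def orient_def)
  finally show ?case by (simp add: add.commute)
qed

lemma fold_tri_step_fans:
  assumes "s \<in> color_pairs" "\<And>j. j < length fs \<Longrightarrow> h (fs ! j) = (b = even j)"
  shows "fold tri_step (concat (map (\<lambda>f. replicate (length f) (h f)) fs)) (orient b s)
    = orient (b = even (length fs)) (fold fan_step (map (\<lambda>f. of_nat (length f)) fs) s)"
  using assms
proof (induction fs arbitrary: b s)
  case Nil
  then show ?case by simp
next
  case (Cons f fs)
  have f: "h f = b" using Cons.prems(2)[of 0] by simp
  have "h (fs ! j) = ((\<not> b) = even j)" if "j < length fs" for j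
    using Cons.prems(2)[of "Suc j"] that by auto
  then have "fold tri_step (concat (map (\<lambda>f. replicate (length f) (h f)) fs)) (orient (\<not> b) (fan_step (of_nat (length f)) s))
    = orient ((\<not> b) = even (length fs)) (fold fan_step (map (\<lambda>f. of_nat (length f)) fs) (fan_step (of_nat (length f)) s))"
    using Cons.IH[OF fan_step_in_color_pairs[OF Cons.prems(1)]] by blast
  then show ?case using f fold_tri_step_fan[OF Cons.prems(1)] by auto
qed

text \<open>The triangle that ends a fan and the one that begins the next fan are consecutive in the ring,
  including the passage from the last fan to the first.\<close>

lemma consecutive_in_concat:
  assumes "j < length fs" "\<forall>f\<in>set fs. f \<noteq> []"
  obtains i where "i < length (concat fs)" "concat fs ! i = last (fs ! j)"
    "concat fs ! (Suc i mod length (concat fs)) = hd (fs ! (Suc j mod length fs))"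
proof -
  define P where "P = concat (take (Suc j) fs)"
  define Q where "Q = concat (drop (Suc j) fs)"
  have PQ: "concat fs = P @ Q" by (simp add: P_def Q_def flip: concat_append)
  have P: "P = concat (take j fs) @ fs ! j" using assms(1) by (simp add: P_def take_Suc_conv_app_nth)
  have ne: "fs ! j \<noteq> []" using assms by simp
  then have P_ne: "P \<noteq> []" using P by simp
  have lP: "concat fs ! (length P - 1) = last (fs ! j)"
  proof -
    have "concat fs ! (length P - 1) = last P"
      using P_ne by (simp add: PQ nth_append last_conv_nth)
    then show ?thesis using P ne by simp
  qed
  have "concat fs ! (length P mod length (concat fs)) = hd (fs ! (Suc j mod length fs))"
  proof (cases "Suc j < length fs")
    case True
    then have d: "drop (Suc j) fs = fs ! Suc j # drop (Suc (Suc j)) fs" by (rule Cons_nth_drop_Suc[symmetric])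
    have n: "fs ! Suc j \<noteq> []" using True assms(2) by simp
    then have "Q \<noteq> []" "hd Q = hd (fs ! Suc j)" by (simp_all add: Q_def d)
    then show ?thesis using True by (simp add: PQ nth_append hd_conv_nth)
  next
    case False
    then have eq: "Suc j = length fs" using assms(1) by simp
    then have "Q = []" by (simp add: Q_def)
    moreover have "hd P = hd (fs ! 0)"
    proof -
      obtain f fs' where fs: "fs = f # fs'" using assms(1) by (cases fs) auto
      then show ?thesis using assms(2) by (simp add: P_def)
    qed
    ultimately show ?thesis using eq P_ne by (simp add: PQ hd_conv_nth)
  qed
  moreover have "Suc (length P - 1) = length P" "length P - 1 < length (concat fs)"
    using P_ne length_greater_0_conv[of P] unfolding PQ length_append by linarith+
  ultimately show ?thesis using that[of "length P - 1"] lP by metis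
qed

text \<open>Prepending an element either extends the first run or opens a new one.\<close>

lemma split_into_runs:
  assumes "ts \<noteq> []"
  shows "\<exists>fs. concat fs = ts \<and> (\<forall>f\<in>set fs. f \<noteq> [] \<and> (\<forall>t\<in>set f. g t = g (hd f))) \<and>
    (\<forall>j. Suc j < length fs \<longrightarrow> g (hd (fs ! j)) \<noteq> g (hd (fs ! Suc j)))"
  using assms
proof (induction ts rule: list_nonempty_induct)
  case (single t)
  show ?case by (intro exI[of _ "[[t]]"]) simp
next
  case (cons t ts)
  then obtain fs where fs: "concat fs = ts" "\<forall>f\<in>set fs. f \<noteq> [] \<and> (\<forall>t\<in>set f. g t = g (hd f))"
    "\<forall>j. Suc j < length fs \<longrightarrow> g (hd (fs ! j)) \<noteq> g (hd (fs ! Suc j))" by blast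
  obtain f fs' where f: "fs = f # fs'" using fs(1) cons.hyps by (cases fs) auto
  show ?case
  proof (cases "g t = g (hd f)")
    case True
    have "hd (((t # f) # fs') ! j) = (if j = 0 then t else hd (fs ! j))" for j
      using f by (cases j) simp_all
    moreover have "g t = g (hd (fs ! 0))" using True f by simp
    ultimately have "\<forall>j. Suc j < length ((t # f) # fs') \<longrightarrow>
        g (hd (((t # f) # fs') ! j)) \<noteq> g (hd (((t # f) # fs') ! Suc j))"
      using fs(3) f by (metis length_Cons nat.distinct(1))
    moreover have "\<forall>f\<in>set ((t # f) # fs'). f \<noteq> [] \<and> (\<forall>t\<in>set f. g t = g (hd f))"
    proof
      fix h assume "h \<in> set ((t # f) # fs')"
      then consider "h = t # f" | "h \<in> set fs" using f by auto
      then show "h \<noteq> [] \<and> (\<forall>t\<in>set h. g t = g (hd h))"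
      proof cases
        case 1
        have "\<forall>s\<in>set f. g s = g (hd f)" using fs(2) f by (metis list.set_intros(1))
        then have "\<forall>s\<in>set f. g s = g t" unfolding True .
        then show ?thesis unfolding 1 list.set list.sel by blast
      next
        case 2
        then show ?thesis using fs(2) by blast
      qed
    qed
    moreover have "concat ((t # f) # fs') = t # ts" using fs(1) f by simp
    ultimately show ?thesis by (intro exI[of _ "(t # f) # fs'"] conjI)
  next
    case False
    have "g (hd (([t] # fs) ! j)) \<noteq> g (hd (([t] # fs) ! Suc j))" if "Suc j < length ([t] # fs)" for j
      using that False fs(3) f by (cases j) simp_all
    moreover have "\<forall>f\<in>set ([t] # fs). f \<noteq> [] \<and> (\<forall>t\<in>set f. g t = g (hd f))"
    proof
      fix h assume "h \<in> set ([t] # fs)"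
      then consider "h = [t]" | "h \<in> set fs" by auto
      then show "h \<noteq> [] \<and> (\<forall>t\<in>set h. g t = g (hd h))"
        using fs(2) by cases (simp, blast)
    qed
    moreover have "concat ([t] # fs) = t # ts" using fs(1) by simp
    ultimately show ?thesis by (intro exI[of _ "[t] # fs"] conjI allI impI)
  qed
qed

context tri_ring
begin

text \<open>The entry edge of the triangle at position \<open>k\<close> is the one it shares with its predecessor, at position
  \<open>k - 1\<close> modulo \<open>N\<close>; this position is \<open>p k\<close>.\<close>

lemma walk_of_cyclic_order:
  assumes ts: "distinct ts" "set ts = Tri"
    and share: "\<And>i. i < length ts \<Longrightarrow>
      \<exists>a\<in>A. \<exists>b\<in>B. {a, b} \<subseteq> V (ts ! i) \<and> {a, b} \<subseteq> V (ts ! (Suc i mod length ts))"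
  obtains x y where "ring_walk A B EA EB Tri V (\<lambda>k. ts ! (k mod length ts)) x y (length ts)"
proof -
  define N where "N = length ts"
  have N: "N \<ge> 3" using card_Tri ts distinct_card N_def by metis
  have "\<forall>i. \<exists>a b. i < N \<longrightarrow> a \<in> A \<and> b \<in> B \<and> {a, b} \<subseteq> V (ts ! i) \<and> {a, b} \<subseteq> V (ts ! (Suc i mod N))"
    using share unfolding N_def by blast
  then obtain f g where fg: "\<And>i. i < N \<Longrightarrow>
      f i \<in> A \<and> g i \<in> B \<and> {f i, g i} \<subseteq> V (ts ! i) \<and> {f i, g i} \<subseteq> V (ts ! (Suc i mod N))"
    by metis
  define p where "p k = (k + N - 1) mod N" for k
  have p: "p k < N" "Suc (p k) mod N = k mod N" "p (Suc k) = k mod N" "p (k + N) = p k" for k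
  proof -
    show "p k < N" using N by (simp add: p_def)
    have "Suc (k + N - 1) = k + N" using N by simp
    then show "Suc (p k) mod N = k mod N" unfolding p_def by (metis mod_Suc_eq mod_add_self2)
    show "p (Suc k) = k mod N" by (simp add: p_def)
    have "k + N + N - 1 = k + N - 1 + N" using N by simp
    then show "p (k + N) = p k" unfolding p_def by (metis mod_add_self2)
  qed
  have "ring_walk A B EA EB Tri V (\<lambda>k. ts ! (k mod N)) (f \<circ> p) (g \<circ> p) N"
  proof (intro ring_walk.intro ring_walk_axioms.intro)
    show "tri_ring A B EA EB Tri V" by (rule tri_ring_axioms)
    show "(\<lambda>k. ts ! (k mod N)) ` {..<N} = Tri"
      using ts(2) by (auto simp: N_def in_set_conv_nth image_iff)
    show "inj_on (\<lambda>k. ts ! (k mod N)) {..<N}"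
      using ts(1) by (auto simp: inj_on_def N_def nth_eq_iff_index_eq)
    fix k
    have kN: "k mod N < N" using N by simp
    show "ts ! ((k + N) mod N) = ts ! (k mod N)" by simp
    show "(f \<circ> p) (k + N) = (f \<circ> p) k" "(g \<circ> p) (k + N) = (g \<circ> p) k" by (simp_all add: p(4))
    show "(f \<circ> p) k \<in> A" "(g \<circ> p) k \<in> B" using fg[OF p(1)] by simp_all
    show "(f \<circ> p) k \<in> V (ts ! (k mod N))" "(g \<circ> p) k \<in> V (ts ! (k mod N))"
      using fg[OF p(1)[of k]] p(2)[of k] by simp_all
    show "(f \<circ> p) (Suc k) \<in> V (ts ! (k mod N))" "(g \<circ> p) (Suc k) \<in> V (ts ! (k mod N))"
      using fg[OF kN] by (simp_all add: p(3))
  qed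
  then show ?thesis using that by (simp add: N_def)
qed

text \<open>Fans alternate between the two sides: if the last triangle of a fan and the first of the next one
  had their cycle edges on the same side, then their common cross edge would force a common apex. So the
  number of fans is even, the orientation at the end agrees with the one at the start, and fixed pairs
  of the walk correspond to fixed pairs of the sequence of parities.\<close>

theorem proper_coloring_iff_fan_parities_in_T:
  fixes ap :: "'t \<Rightarrow> 'v"
  assumes ap: "\<And>t. t \<in> Tri \<Longrightarrow> on_A t \<Longrightarrow> V t \<inter> B = {ap t}" "\<And>t. t \<in> Tri \<Longrightarrow> \<not> on_A t \<Longrightarrow> V t \<inter> A = {ap t}"
    and ts: "distinct (concat fs)" "set (concat fs) = Tri"
      "\<And>i. i < length (concat fs) \<Longrightarrow> \<exists>a\<in>A. \<exists>b\<in>B. {a, b} \<subseteq> V (concat fs ! i) \<and>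
        {a, b} \<subseteq> V (concat fs ! (Suc i mod length (concat fs)))"
    and fs: "\<forall>f\<in>set fs. f \<noteq> [] \<and> (\<forall>t\<in>set f. ap t = ap (hd f))"
      "\<forall>j<length fs. ap (hd (fs ! j)) \<noteq> ap (hd (fs ! (Suc j mod length fs)))"
  shows "(\<exists>col :: 'v \<Rightarrow> nat. (\<forall>v\<in>A \<union> B. col v < 3) \<and> (\<forall>s\<in>Tri. inj_on col (V s))) \<longleftrightarrow>
    map (\<lambda>f. of_nat (length f)) fs \<in> T"
proof -
  define N where "N = length (concat fs)"
  define m where "m = length fs"
  obtain x y where "ring_walk A B EA EB Tri V (\<lambda>k. concat fs ! (k mod N)) x y N"
    using walk_of_cyclic_order[OF ts] unfolding N_def by blast
  then interpret ring_walk A B EA EB Tri V "\<lambda>k. concat fs ! (k mod N)" x y N .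
  define h where "h f = on_A (hd f)" for f
  have f_tri: "t \<in> Tri" if "f \<in> set fs" "t \<in> set f" for f t using ts(2) that by auto
  have hd_in: "hd f \<in> set f" "last f \<in> set f" if "f \<in> set fs" for f using fs(1) that by auto
  have side: "on_A t \<longleftrightarrow> ap t \<in> B" if "t \<in> Tri" for t
    using ap[OF that] disjoint by blast
  have h: "on_A t = h f" if "f \<in> set fs" "t \<in> set f" for f t
  proof -
    have "ap t = ap (hd f)" using fs(1) that by blast
    then show ?thesis unfolding h_def using side f_tri hd_in that by metis
  qed
  have types: "map (\<lambda>k. on_A (concat fs ! (k mod N))) [0..<N]
      = concat (map (\<lambda>f. replicate (length f) (h f)) fs)"
  proof -
    have "map (\<lambda>k. on_A (concat fs ! (k mod N))) [0..<N] = map on_A (concat fs)"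
      by (intro nth_equalityI) (auto simp: N_def)
    also have "\<dots> = concat (map (map on_A) fs)" by (simp add: map_concat)
    also have "map (map on_A) fs = map (\<lambda>f. replicate (length f) (h f)) fs"
      using h by (intro map_cong refl) (simp add: map_replicate_const[symmetric])
    finally show ?thesis .
  qed
  have alt: "h (fs ! (Suc j mod m)) \<noteq> h (fs ! j)" if j: "j < m" for j
  proof
    assume eq: "h (fs ! (Suc j mod m)) = h (fs ! j)"
    obtain i where i: "i < N" "concat fs ! i = last (fs ! j)"
      "concat fs ! (Suc i mod N) = hd (fs ! (Suc j mod m))"
      using consecutive_in_concat[of j fs] fs(1) j unfolding N_def m_def by blast
    have in_fs: "fs ! j \<in> set fs" "fs ! (Suc j mod m) \<in> set fs"
      using j mod_less_divisor[of m "Suc j"] nth_mem[of "Suc j mod m" fs] nth_mem[of j fs]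
      unfolding m_def by (metis gr_zeroI not_less_zero)+
    define s s' where "s = concat fs ! (i mod N)" and "s' = concat fs ! (Suc i mod N)"
    have s: "s = last (fs ! j)" "s' = hd (fs ! (Suc j mod m))" using i by (simp_all add: s_def s'_def)
    have tri: "s \<in> Tri" "s' \<in> Tri" using f_tri in_fs hd_in s by metis+
    have on: "on_A s = on_A s'" using h in_fs hd_in s eq by metis
    have "ap s = ap (hd (fs ! j))" using fs(1) in_fs(1) hd_in(2) s(1) by blast
    then have "ap s \<noteq> ap s'" using fs(2) j s by (simp add: m_def)
    moreover have "ap s = ap s'"
    proof (cases "on_A s")
      case True
      then have "{ap s} = {y i}" "{ap s'} = {y i}"
        using ap(1) tri on A_step(1,2)[of i] A_step(2)[of "Suc i"] by (simp_all add: s_def s'_def)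
      then show ?thesis by simp
    next
      case False
      then have "{ap s} = {x i}" "{ap s'} = {x i}"
        using ap(2) tri on B_step(1,2)[of i] B_step(2)[of "Suc i"] by (simp_all add: s_def s'_def)
      then show ?thesis by simp
    qed
    ultimately show False by simp
  qed
  have m: "m > 0" using N_ge by (cases fs) (auto simp: N_def m_def)
  define b where "b = h (fs ! 0)"
  have hj: "h (fs ! j) = (b = even j)" if "j < m" for j
    using that
  proof (induction j)
    case (Suc j)
    then show ?case using alt[of j] by auto
  qed (simp add: b_def)
  have even: "even m"
    using alt[of "m - 1"] hj[of "m - 1"] m by (auto simp: b_def)
  let ?p = "map (\<lambda>f. of_nat (length f)) fs :: parity_seq"
  have fold: "fold tri_step (map (\<lambda>k. on_A (concat fs ! (k mod N))) [0..<N]) (orient b s)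
      = orient b (fold fan_step ?p s)" if "s \<in> color_pairs" for s
    unfolding types using fold_tri_step_fans[OF that, of fs h b] hj even by (simp add: m_def)
  have "(\<exists>col :: 'v \<Rightarrow> nat. (\<forall>v\<in>A \<union> B. col v < 3) \<and> (\<forall>s\<in>Tri. inj_on col (V s))) \<longleftrightarrow>
      (\<exists>s\<in>color_pairs. fold tri_step (map (\<lambda>k. on_A (concat fs ! (k mod N))) [0..<N]) s = s)"
    by (rule proper_coloring_iff_fixed_pair)
  also have "\<dots> \<longleftrightarrow> (\<exists>s\<in>color_pairs. orient b (fold fan_step ?p s) = orient b s)"
  proof
    assume "\<exists>s\<in>color_pairs. fold tri_step (map (\<lambda>k. on_A (concat fs ! (k mod N))) [0..<N]) s = s"
    then obtain s where s: "s \<in> color_pairs"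
      "fold tri_step (map (\<lambda>k. on_A (concat fs ! (k mod N))) [0..<N]) s = s" by blast
    then show "\<exists>s\<in>color_pairs. orient b (fold fan_step ?p s) = orient b s"
      using fold[of "orient b s"] by (intro bexI[of _ "orient b s"]) (simp_all add: orient_orient orient_color_pairs)
  next
    assume "\<exists>s\<in>color_pairs. orient b (fold fan_step ?p s) = orient b s"
    then obtain s where s: "s \<in> color_pairs" "orient b (fold fan_step ?p s) = orient b s" by blast
    then show "\<exists>s\<in>color_pairs. fold tri_step (map (\<lambda>k. on_A (concat fs ! (k mod N))) [0..<N]) s = s"
      using fold[OF s(1)] by (intro bexI[of _ "orient b s"]) (simp_all add: orient_color_pairs)
  qed
  also have "\<dots> \<longleftrightarrow> closes_up ?p"
    unfolding closes_up_def by (intro bex_cong refl) (metis orient_orient)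
  also have "\<dots> \<longleftrightarrow> ?p \<in> T"
  proof -
    have "m \<ge> 2" using even m by (cases "m = 1") auto
    then show ?thesis using T_iff_closes_up[of ?p] even by (simp add: m_def)
  qed
  finally show ?thesis .
qed

end

section \<open>Triangulated rings\<close>

lemma card_cycle_edges_at:
  assumes "distinct c" "length c \<ge> 3" "a \<in> set c"
  shows "card {e \<in> cycle_edges c. a \<in> e} = 2"
proof -
  obtain i where i: "i < length c" "c ! i = a" using assms(3) by (auto simp: in_set_conv_nth)
  define d where "d = rotate i c"
  have d: "distinct d" "length d = length c" "cycle_edges d = cycle_edges c" "hd d = a" "d \<noteq> []"
    using assms i hd_rotate_conv_nth[of c i] by (auto simp: d_def cycle_edges_rotate simp flip: length_greater_0_conv)
  then obtain b v vs where dv: "d = a # b # v # vs"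
    using assms(2) by (metis Suc_le_length_iff list.sel(1) numeral_3_eq_3)
  have notin: "a \<notin> e" if "e \<in> path_edges (b # v # vs)" for e
    using path_edges_subset_set[OF that] d(1) dv by auto
  have last: "last d \<noteq> b" using d(1) dv by (auto split: if_splits dest: last_in_set)
  have "cycle_edges c = insert {last d, a} (insert {a, b} (path_edges (b # v # vs)))"
    using cycle_edges_conv_path_edges[OF d(5)] d(3,4) dv by simp
  then have "{e \<in> cycle_edges c. a \<in> e} = {{last d, a}, {a, b}}" using notin by auto
  moreover have "{last d, a} \<noteq> {a, b}" using last by (auto simp: doubleton_eq_iff)
  ultimately show ?thesis by simp
qed

text \<open>Propagation along the path from its first vertex, where some edge of \<open>S\<close> is attached.\<close>

lemma path_edges_reachable:
  assumes "\<And>e e'. e \<in> S \<Longrightarrow> e' \<in> path_edges vs \<Longrightarrow> e \<inter> e' \<noteq> {} \<Longrightarrow> e' \<in> S"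
    and "e \<in> S" "hd vs \<in> e"
  shows "path_edges vs \<subseteq> S"
  using assms
proof (induction vs arbitrary: e rule: path_edges.induct)
  case (1 u v vs)
  have uv: "{u, v} \<in> S" using 1(2)[of e "{u, v}"] 1(3,4) by auto
  have "path_edges (v # vs) \<subseteq> S"
  proof (rule "1.IH"[OF _ uv])
    show "e' \<in> S" if "e \<in> S" "e' \<in> path_edges (v # vs)" "e \<inter> e' \<noteq> {}" for e e'
      using 1(2)[of e e'] that by simp
  qed simp
  then show ?case using uv by simp
qed auto

lemma cycle_edges_connected:
  assumes "distinct c" "length c \<ge> 3" "S \<subseteq> cycle_edges c" "S \<noteq> {}"
    and closed: "\<And>e e'. e \<in> S \<Longrightarrow> e' \<in> cycle_edges c \<Longrightarrow> e \<inter> e' \<noteq> {} \<Longrightarrow> e' \<in> S"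
  shows "S = cycle_edges c"
proof -
  obtain e where e: "e \<in> S" using assms(4) by blast
  then have ec: "e \<in> cycle_edges c" using assms(3) by blast
  obtain d where d: "e = {last d, hd d}" "cycle_edges c = insert e (path_edges d)"
    using cycle_edges_split[OF ec assms(2,1)] by metis
  have "path_edges d \<subseteq> S"
    using closed d e by (intro path_edges_reachable[of S d e]) auto
  then have "cycle_edges c \<subseteq> S" using d(2) e by simp
  with assms(3) show ?thesis by (rule equalityI)
qed

lemma face_verts_of_facial_cycle:
  assumes "plane_graph G" "facial_cycle G F c"
  shows "face_verts G F = set c"
proof -
  have fr: "frontier F = (\<Union>e\<in>cycle_edges c. edge_arc G e)" and ce: "cycle_edges c \<subseteq> edges G"
    and c: "set c \<subseteq> verts G"
    using assms(2) by (auto simp: facial_cycle_def is_cycle_def)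
  have "v \<in> edge_arc G e \<longleftrightarrow> v \<in> e" if "v \<in> verts G" "e \<in> cycle_edges c" for v e
    using plane_graphD(4)[OF assms(1), of e] that ce by blast
  then have "face_verts G F = {v \<in> verts G. \<exists>e\<in>cycle_edges c. v \<in> e}"
    unfolding face_verts_def fr by blast
  also have "\<dots> = set c"
  proof
    show "{v \<in> verts G. \<exists>e\<in>cycle_edges c. v \<in> e} \<subseteq> set c" using cycle_edges_subset_set by blast
    show "set c \<subseteq> {v \<in> verts G. \<exists>e\<in>cycle_edges c. v \<in> e}"
    proof
      fix v assume v: "v \<in> set c"
      then obtain i where "i < length c" "v = c ! i" by (auto simp: in_set_conv_nth)
      then have "{c ! i, c ! (Suc i mod length c)} \<in> cycle_edges c" "v \<in> {c ! i, c ! (Suc i mod length c)}"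
        by (auto simp: cycle_edges_def)
      then show "v \<in> {v \<in> verts G. \<exists>e\<in>cycle_edges c. v \<in> e}" using v c by blast
    qed
  qed
  finally show ?thesis .
qed

text \<open>On three vertices the cycle consists of all pairs, so incidence of edges with a triangular face
  is a matter of vertices only.\<close>

lemma facial_triangle:
  assumes "plane_graph G" "facial_cycle G F c" "length c = 3"
  shows "card (face_verts G F) = 3" "face_edges G F = {e \<in> edges G. e \<subseteq> face_verts G F}"
    "\<And>u v. u \<in> face_verts G F \<Longrightarrow> v \<in> face_verts G F \<Longrightarrow> u \<noteq> v \<Longrightarrow> {u, v} \<in> face_edges G F"
proof -
  obtain p q r where c: "c = [p, q, r]" using assms(3) by (auto simp: numeral_3_eq_3 length_Suc_conv)
  have dist: "distinct c" and ce: "cycle_edges c \<subseteq> edges G"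
    using assms(2) by (auto simp: facial_cycle_def is_cycle_def)
  note fv = face_verts_of_facial_cycle[OF assms(1,2)] and fe = face_edges_of_facial_cycle[OF assms(1,2)]
  show "card (face_verts G F) = 3" using dist distinct_card[OF dist] assms(3) fv by simp
  have cyc: "cycle_edges c = {{r, p}, {p, q}, {q, r}}" by (simp add: c cycle_edges_conv_path_edges)
  show pairs: "\<And>u v. u \<in> face_verts G F \<Longrightarrow> v \<in> face_verts G F \<Longrightarrow> u \<noteq> v \<Longrightarrow> {u, v} \<in> face_edges G F"
    unfolding fv fe cyc by (auto simp: c doubleton_eq_iff)
  show "face_edges G F = {e \<in> edges G. e \<subseteq> face_verts G F}"
  proof
    show "face_edges G F \<subseteq> {e \<in> edges G. e \<subseteq> face_verts G F}"
      using ce cycle_edges_subset_set[of _ c] unfolding fe fv by blast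
    show "{e \<in> edges G. e \<subseteq> face_verts G F} \<subseteq> face_edges G F"
    proof
      fix e assume e: "e \<in> {e \<in> edges G. e \<subseteq> face_verts G F}"
      then obtain u v where "e = {u, v}" "u \<noteq> v" using edge_doubleton[OF assms(1), of e] by blast
      then show "e \<in> face_edges G F" using pairs e by simp
    qed
  qed
qed

locale triangulated_ring_graph =
  fixes G :: ring_graph
  assumes ring: "triangulated_ring G"
begin

abbreviation "A \<equiv> set (inner_cycle G)"
abbreviation "B \<equiv> set (outer_cycle G)"
abbreviation "EA \<equiv> cycle_edges (inner_cycle G)"
abbreviation "EB \<equiv> cycle_edges (outer_cycle G)"
abbreviation "V \<equiv> face_verts G"

lemma
  shows plane: "plane_graph G"
    and inner: "inner_face G \<in> faces G" "facial_cycle G (inner_face G) (inner_cycle G)"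
    and outer: "outer_face G \<in> faces G" "facial_cycle G (outer_face G) (outer_cycle G)"
    and inner_neq_outer: "inner_face G \<noteq> outer_face G"
    and induced: "induced_cycle G (inner_cycle G)" "induced_cycle G (outer_cycle G)"
    and verts: "A \<union> B = verts G" "A \<inter> B = {}"
    and triangle_cycle: "\<And>t. t \<in> triangles G \<Longrightarrow> \<exists>c. facial_cycle G t c \<and> length c = 3"
  using ring unfolding triangulated_ring_def triangles_def by auto

lemma cycles:
  "distinct (inner_cycle G)" "length (inner_cycle G) \<ge> 3" "EA \<subseteq> edges G"
  "distinct (outer_cycle G)" "length (outer_cycle G) \<ge> 3" "EB \<subseteq> edges G"
  using induced by (auto simp: induced_cycle_def is_cycle_def)

lemma triangle:
  assumes "t \<in> triangles G"
  shows "t \<in> faces G" "card (V t) = 3" "face_edges G t = {e \<in> edges G. e \<subseteq> V t}"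
    "\<And>u v. u \<in> V t \<Longrightarrow> v \<in> V t \<Longrightarrow> u \<noteq> v \<Longrightarrow> {u, v} \<in> face_edges G t"
proof -
  obtain c where c: "facial_cycle G t c" "length c = 3" using triangle_cycle[OF assms] by blast
  show "t \<in> faces G" using assms by (simp add: triangles_def)
  show "card (V t) = 3" "face_edges G t = {e \<in> edges G. e \<subseteq> V t}"
    "\<And>u v. u \<in> V t \<Longrightarrow> v \<in> V t \<Longrightarrow> u \<noteq> v \<Longrightarrow> {u, v} \<in> face_edges G t"
    using facial_triangle[OF plane c] by blast+
qed

lemma every_face_has_facial_cycle: "F \<in> faces G \<Longrightarrow> \<exists>c. facial_cycle G F c"
  using inner outer triangle_cycle unfolding triangles_def by blast

lemma inner_face_edges: "face_edges G (inner_face G) = EA"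
  using face_edges_of_facial_cycle[OF plane inner(2)] .

lemma outer_face_edges: "face_edges G (outer_face G) = EB"
  using face_edges_of_facial_cycle[OF plane outer(2)] .

lemma edge_two_faces: "e \<in> edges G \<Longrightarrow> card {F \<in> faces G. e \<in> face_edges G F} = 2"
  using edge_on_exactly_two_faces[OF plane every_face_has_facial_cycle] .

lemma edge_card: "e \<in> edges G \<Longrightarrow> card e = 2"
  using edge_doubleton[OF plane] by (metis card_2_iff)

text \<open>A triangle with all its vertices on an induced facial cycle would have its boundary inside that
  cycle, and then every vertex of the graph would lie on the cycle.\<close>

lemma triangle_not_in_cycle:
  assumes t: "t \<in> triangles G" and F: "F \<in> faces G" "facial_cycle G F c" "F \<noteq> t" "induced_cycle G c"
    and v: "v \<in> verts G" "v \<notin> set c"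
  shows "\<not> V t \<subseteq> set c"
proof
  assume sub: "V t \<subseteq> set c"
  obtain d where d: "facial_cycle G t d" using triangle_cycle[OF t] by blast
  have "cycle_edges d \<subseteq> cycle_edges c"
    using sub triangle(3)[OF t] F(4) unfolding face_edges_of_facial_cycle[OF plane d] induced_cycle_def by auto
  then have "frontier t \<subseteq> frontier F" using d F(2) by (auto simp: facial_cycle_def)
  then have "point_set G \<subseteq> frontier F"
    using point_set_subset_nested_frontier[OF plane F(1,2) triangle(1)[OF t] F(3)] by blast
  then have "v \<in> V F" using v by (auto simp: face_verts_def point_set_def)
  then show False using face_verts_of_facial_cycle[OF plane F(2)] v(2) by simp
qed

text \<open>Of the two faces at an edge of a distinguished cycle one is the distinguished face itself, and the
  other one is not the second distinguished face.\<close>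

lemma unique_triangle_on_cycle_edge:
  assumes "e \<in> edges G" "F \<in> {inner_face G, outer_face G}" "F' \<in> {inner_face G, outer_face G}" "F \<noteq> F'"
    "e \<in> face_edges G F" "e \<notin> face_edges G F'"
  shows "\<exists>!t. t \<in> triangles G \<and> e \<subseteq> V t"
proof -
  let ?S = "{H \<in> faces G. e \<in> face_edges G H}"
  have F: "F \<in> ?S" using assms(2,5) inner outer by auto
  obtain t where t: "?S = {F, t}" "t \<noteq> F"
    using card_2_other[OF edge_two_faces[OF assms(1)] F] .
  have split: "faces G = triangles G \<union> {F, F'}" "F \<notin> triangles G"
    using assms(2-4) inner outer by (auto simp: triangles_def)
  have on: "e \<subseteq> V s \<longleftrightarrow> e \<in> face_edges G s" if "s \<in> triangles G" for s
    using triangle(3)[OF that] assms(1) by simp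
  have "t \<in> triangles G" "e \<in> face_edges G t" using t split assms(6) by blast+
  moreover have "s = t" if "s \<in> triangles G" "e \<in> face_edges G s" for s
  proof -
    have "s \<in> ?S" using that triangle(1) by simp
    then have "s \<in> {F, t}" using t(1) by simp
    then show ?thesis using that(1) split(2) by auto
  qed
  ultimately show ?thesis using on by blast
qed

lemma finite_triangles: "finite (triangles G)"
proof (rule finite_subset)
  show "triangles G \<subseteq> (\<Union>e\<in>edges G. {F \<in> faces G. e \<in> face_edges G F})"
  proof
    fix t assume t: "t \<in> triangles G"
    obtain u v where "u \<in> V t" "v \<in> V t" "u \<noteq> v"
      using triangle(2)[OF t] by (metis card_3_iff insertI1 insertI2)
    then have "{u, v} \<in> face_edges G t" using triangle(4)[OF t] by blast
    then show "t \<in> (\<Union>e\<in>edges G. {F \<in> faces G. e \<in> face_edges G F})"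
      using triangle(1)[OF t] by (auto simp: face_edges_def)
  qed
  show "finite (\<Union>e\<in>edges G. {F \<in> faces G. e \<in> face_edges G F})"
    using finite_edges[OF plane] edge_two_faces by (auto intro: card_ge_0_finite)
qed

lemma cycle_edge_disjoint: "e \<in> EA \<Longrightarrow> e \<notin> EB"
proof
  assume e: "e \<in> EA" "e \<in> EB"
  then have "e \<subseteq> A \<inter> B" using cycle_edges_subset_set by blast
  then have "e = {}" using verts(2) by simp
  then show False using edge_card[of e] e(1) cycles(3) by auto
qed

lemma triangles_at_cross_edge:
  assumes "a \<in> A" "b \<in> B" "t \<in> triangles G" "a \<in> V t" "b \<in> V t"
  shows "{a, b} \<in> edges G" "card {t \<in> triangles G. a \<in> V t \<and> b \<in> V t} = 2"
proof -
  have ne: "a \<noteq> b" using assms(1,2) verts(2) by blast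
  show e: "{a, b} \<in> edges G" using triangle(4)[OF assms(3-5) ne] by (simp add: face_edges_def)
  have "{a, b} \<notin> EA" "{a, b} \<notin> EB"
    using assms(1,2) verts(2) cycle_edges_subset_set[of "{a, b}"] by blast+
  then have "{F \<in> faces G. {a, b} \<in> face_edges G F} = {t \<in> triangles G. a \<in> V t \<and> b \<in> V t}"
  proof (intro Collect_cong)
    fix F
    show "F \<in> faces G \<and> {a, b} \<in> face_edges G F \<longleftrightarrow> F \<in> triangles G \<and> a \<in> V F \<and> b \<in> V F"
    proof (cases "F \<in> triangles G")
      case True
      then show ?thesis using triangle(1,3)[OF True] e by simp
    next
      case False
      then have "F \<in> faces G \<longrightarrow> F = inner_face G \<or> F = outer_face G" by (auto simp: triangles_def)
      then show ?thesis
        using False \<open>{a, b} \<notin> EA\<close> \<open>{a, b} \<notin> EB\<close> inner_face_edges outer_face_edges by auto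
    qed
  qed
  then show "card {t \<in> triangles G. a \<in> V t \<and> b \<in> V t} = 2" using edge_two_faces[OF e] by simp
qed

sublocale tri_ring A B EA EB "triangles G" V
proof
  have memA: "hd (inner_cycle G) \<in> A" and memB: "hd (outer_cycle G) \<in> B"
    using cycles(2,5) by (auto intro!: hd_in_set)
  then have neA: "hd (inner_cycle G) \<in> verts G" "hd (inner_cycle G) \<notin> B"
    and neB: "hd (outer_cycle G) \<in> verts G" "hd (outer_cycle G) \<notin> A" using verts by blast+
  show "finite (triangles G)" by (rule finite_triangles)
  show "A \<inter> B = {}" by (rule verts(2))
  show "e \<subseteq> A \<and> card e = 2" if "e \<in> EA" for e
    using that cycle_edges_subset_set edge_card cycles by blast
  show "e \<subseteq> B \<and> card e = 2" if "e \<in> EB" for e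
    using that cycle_edges_subset_set edge_card cycles by blast
  show "EA \<noteq> {}" "EB \<noteq> {}"
    using card_cycle_edges_at[OF cycles(1,2) memA] card_cycle_edges_at[OF cycles(4,5) memB] by auto
  show "card {e \<in> EA. a \<in> e} = 2" if "a \<in> A" for a using card_cycle_edges_at[OF cycles(1,2) that] .
  show "card {e \<in> EB. b \<in> e} = 2" if "b \<in> B" for b using card_cycle_edges_at[OF cycles(4,5) that] .
  show "S = EA" if "S \<subseteq> EA" "S \<noteq> {}" "\<And>e e'. e \<in> S \<Longrightarrow> e' \<in> EA \<Longrightarrow> e \<inter> e' \<noteq> {} \<Longrightarrow> e' \<in> S" for S
    using cycle_edges_connected[OF cycles(1,2) that] .
  show "S = EB" if "S \<subseteq> EB" "S \<noteq> {}" "\<And>e e'. e \<in> S \<Longrightarrow> e' \<in> EB \<Longrightarrow> e \<inter> e' \<noteq> {} \<Longrightarrow> e' \<in> S" for S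
    using cycle_edges_connected[OF cycles(4,5) that] .
  show "\<exists>!t. t \<in> triangles G \<and> e \<subseteq> V t" if "e \<in> EA" for e
  proof (rule unique_triangle_on_cycle_edge[of e "inner_face G" "outer_face G"])
    show "e \<in> edges G" using that cycles(3) by blast
  qed (use that cycle_edge_disjoint in \<open>simp_all add: inner_neq_outer inner_face_edges outer_face_edges\<close>)
  show "\<exists>!t. t \<in> triangles G \<and> e \<subseteq> V t" if "e \<in> EB" for e
  proof (rule unique_triangle_on_cycle_edge[of e "outer_face G" "inner_face G"])
    show "e \<in> edges G" using that cycles(6) by blast
    show "e \<notin> face_edges G (inner_face G)" using that cycle_edge_disjoint inner_face_edges by blast
  qed (use that in \<open>simp_all add: inner_neq_outer[symmetric] outer_face_edges\<close>)
  show "card {t \<in> triangles G. a \<in> V t \<and> b \<in> V t} = 2"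
    if "a \<in> A" "b \<in> B" "t \<in> triangles G" "a \<in> V t" "b \<in> V t" for a b t
    using triangles_at_cross_edge[OF that] by simp
  show "V t \<subseteq> A \<union> B \<and> (V t \<inter> A \<in> EA \<and> card (V t \<inter> B) = 1 \<or> V t \<inter> B \<in> EB \<and> card (V t \<inter> A) = 1)"
    if t: "t \<in> triangles G" for t
  proof -
    have sub: "V t \<subseteq> A \<union> B" using verts(1) by (auto simp: face_verts_def)
    have neq: "inner_face G \<noteq> t" "outer_face G \<noteq> t" using t by (auto simp: triangles_def)
    have "\<not> V t \<subseteq> A" "\<not> V t \<subseteq> B"
      using triangle_not_in_cycle[OF t inner neq(1) induced(1) neB]
        triangle_not_in_cycle[OF t outer neq(2) induced(2) neA] by blast+
    then have ne: "V t \<inter> A \<noteq> {}" "V t \<inter> B \<noteq> {}" using sub by blast+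
    have "V t = (V t \<inter> A) \<union> (V t \<inter> B)" using sub by blast
    then have "card (V t \<inter> A) + card (V t \<inter> B) = 3"
      using triangle(2)[OF t] card_Un_disjoint[of "V t \<inter> A" "V t \<inter> B"] verts(2) by auto
    moreover have "card (V t \<inter> A) > 0" "card (V t \<inter> B) > 0" using ne by (simp_all add: card_gt_0_iff)
    ultimately have "card (V t \<inter> A) = 2 \<and> card (V t \<inter> B) = 1 \<or> card (V t \<inter> B) = 2 \<and> card (V t \<inter> A) = 1"
      by linarith
    moreover have pair: "V t \<inter> set c \<in> cycle_edges c"
      if c: "card (V t \<inter> set c) = 2" "induced_cycle G c" for c
    proof -
      obtain u v where uv: "V t \<inter> set c = {u, v}" "u \<noteq> v"
        using c(1) unfolding card_2_iff by blast
      have "u \<in> V t" "v \<in> V t" using uv(1) by auto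
      then have "{u, v} \<in> face_edges G t" using triangle(4)[OF t] uv(2) by simp
      then have "{u, v} \<in> edges G" by (simp add: face_edges_def)
      moreover have "{u, v} \<subseteq> set c" using uv(1) by auto
      ultimately show ?thesis using c(2) unfolding uv(1) induced_cycle_def by simp
    qed
    ultimately show ?thesis using sub induced by blast
  qed
qed simp_all

lemma apex_on_A:
  assumes "t \<in> triangles G" "on_A t"
  shows "V t \<inter> B = {apex G t}"
proof -
  obtain b where b: "V t \<inter> B = {b}" using on_A_cards(2)[OF assms] card_1_singletonE by blast
  have e: "V t \<inter> A \<in> EA" "V t \<inter> A \<in> face_edges G t"
    using assms(2) triangle(3)[OF assms(1)] cycles(3) by (auto simp: on_A_def)
  have "apex G t = b" unfolding apex_def
  proof (rule the_equality)
    show "b \<in> V t \<and> (\<exists>e\<in>face_edges G t. b \<in> B \<and> e \<in> EA \<or> b \<in> A \<and> e \<in> EB)" using b e by blast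
    fix x assume x: "x \<in> V t \<and> (\<exists>e\<in>face_edges G t. x \<in> B \<and> e \<in> EA \<or> x \<in> A \<and> e \<in> EB)"
    have "e \<notin> EB" if "e \<in> face_edges G t" for e
    proof
      assume "e \<in> EB"
      then have "e \<subseteq> V t \<inter> B" "card e = 2" using EB_sub triangle(3)[OF assms(1)] that by auto
      then show False using card_mono[of "V t \<inter> B" e] b by simp
    qed
    then show "x = b" using x b by blast
  qed
  then show ?thesis using b by simp
qed

lemma apex_not_on_A:
  assumes "t \<in> triangles G" "\<not> on_A t"
  shows "V t \<inter> A = {apex G t}"
proof -
  obtain a where a: "V t \<inter> A = {a}" using not_on_A(3)[OF assms] card_1_singletonE by blast
  have e: "V t \<inter> B \<in> EB" "V t \<inter> B \<in> face_edges G t"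
    using not_on_A(1)[OF assms] triangle(3)[OF assms(1)] cycles(6) by auto
  have "apex G t = a" unfolding apex_def
  proof (rule the_equality)
    show "a \<in> V t \<and> (\<exists>e\<in>face_edges G t. a \<in> B \<and> e \<in> EA \<or> a \<in> A \<and> e \<in> EB)" using a e by blast
    fix x assume x: "x \<in> V t \<and> (\<exists>e\<in>face_edges G t. x \<in> B \<and> e \<in> EA \<or> x \<in> A \<and> e \<in> EB)"
    have "e \<notin> EA" if "e \<in> face_edges G t" for e
      using edge_in_triangle(1)[of e t] triangle(3)[OF assms(1)] that assms by auto
    then show "x = a" using x a by blast
  qed
  then show ?thesis using a by simp
qed

lemma ring_order_iff:
  "ring_order G ts \<longleftrightarrow> distinct ts \<and> set ts = triangles G \<and>
     (\<forall>i<length ts. \<exists>a\<in>A. \<exists>b\<in>B. {a, b} \<subseteq> V (ts ! i) \<and> {a, b} \<subseteq> V (ts ! (Suc i mod length ts)))"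
proof -
  have "(\<exists>e\<in>cross_edges G. e \<in> face_edges G t \<and> e \<in> face_edges G t') \<longleftrightarrow>
      (\<exists>a\<in>A. \<exists>b\<in>B. {a, b} \<subseteq> V t \<and> {a, b} \<subseteq> V t')"
    if t: "t \<in> triangles G" "t' \<in> triangles G" for t t'
  proof
    assume "\<exists>e\<in>cross_edges G. e \<in> face_edges G t \<and> e \<in> face_edges G t'"
    then obtain a b where "a \<in> A" "b \<in> B" "{a, b} \<in> face_edges G t" "{a, b} \<in> face_edges G t'"
      unfolding cross_edges_def by blast
    then show "\<exists>a\<in>A. \<exists>b\<in>B. {a, b} \<subseteq> V t \<and> {a, b} \<subseteq> V t'"
      unfolding triangle(3)[OF t(1)] triangle(3)[OF t(2)] by blast
  next
    assume "\<exists>a\<in>A. \<exists>b\<in>B. {a, b} \<subseteq> V t \<and> {a, b} \<subseteq> V t'"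
    then obtain a b where ab: "a \<in> A" "b \<in> B" "{a, b} \<subseteq> V t" "{a, b} \<subseteq> V t'" by blast
    have e: "{a, b} \<in> edges G" using triangles_at_cross_edge(1)[OF ab(1,2) t(1)] ab(3) by simp
    then have "{a, b} \<in> cross_edges G" using ab(1,2) unfolding cross_edges_def by blast
    moreover have "{a, b} \<in> face_edges G t" "{a, b} \<in> face_edges G t'"
      using e ab(3,4) triangle(3)[OF t(1)] triangle(3)[OF t(2)] by simp_all
    ultimately show "\<exists>e\<in>cross_edges G. e \<in> face_edges G t \<and> e \<in> face_edges G t'"
      by blast
  qed
  moreover have "ts ! i \<in> set ts" "ts ! (Suc i mod length ts) \<in> set ts" if "i < length ts" for i
    using that mod_less_divisor[of "length ts" "Suc i"] by (metis nth_mem gr_zeroI not_less_zero)+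
  ultimately have "(\<exists>e\<in>cross_edges G. e \<in> face_edges G (ts ! i) \<and> e \<in> face_edges G (ts ! (Suc i mod length ts))) \<longleftrightarrow>
      (\<exists>a\<in>A. \<exists>b\<in>B. {a, b} \<subseteq> V (ts ! i) \<and> {a, b} \<subseteq> V (ts ! (Suc i mod length ts)))"
    if "set ts = triangles G" "i < length ts" for i
    using that by simp
  then show ?thesis unfolding ring_order_def by (intro conj_cong refl all_cong)
qed

lemma three_colorable_iff:
  "three_colorable G \<longleftrightarrow>
    (\<exists>col :: complex \<Rightarrow> nat. (\<forall>v\<in>A \<union> B. col v < 3) \<and> (\<forall>t\<in>triangles G. inj_on col (V t)))"
proof -
  have "(\<forall>u v. {u, v} \<in> edges G \<longrightarrow> col u \<noteq> col v) \<longleftrightarrow> (\<forall>t\<in>triangles G. inj_on col (V t))"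
    for col :: "complex \<Rightarrow> nat"
  proof
    assume col: "\<forall>u v. {u, v} \<in> edges G \<longrightarrow> col u \<noteq> col v"
    show "\<forall>t\<in>triangles G. inj_on col (V t)"
    proof (intro ballI inj_onI)
      fix t u v assume "t \<in> triangles G" "u \<in> V t" "v \<in> V t" "col u = col v"
      then show "u = v" using triangle(4)[of t u v] col by (auto simp: face_edges_def)
    qed
  next
    assume inj: "\<forall>t\<in>triangles G. inj_on col (V t)"
    show "\<forall>u v. {u, v} \<in> edges G \<longrightarrow> col u \<noteq> col v"
    proof (intro allI impI)
      fix u v assume e: "{u, v} \<in> edges G"
      let ?S = "{F \<in> faces G. {u, v} \<in> face_edges G F}"
      have "\<exists>t\<in>triangles G. {u, v} \<in> face_edges G t"
      proof (rule ccontr)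
        assume "\<not> ?thesis"
        then have sub: "?S \<subseteq> {inner_face G, outer_face G}" by (auto simp: triangles_def)
        have "card {inner_face G, outer_face G} = 2" using inner_neq_outer by simp
        then have "?S = {inner_face G, outer_face G}"
          using card_subset_eq[OF _ sub] edge_two_faces[OF e] by simp
        then have "{u, v} \<in> face_edges G (inner_face G)" "{u, v} \<in> face_edges G (outer_face G)" by blast+
        then show False using inner_face_edges outer_face_edges cycle_edge_disjoint by blast
      qed
      then obtain t where "t \<in> triangles G" "{u, v} \<subseteq> V t" using triangle(3) by blast
      then show "col u \<noteq> col v" using inj edge_ends_distinct[OF plane e] unfolding inj_on_def by blast
    qed
  qed
  then show ?thesis unfolding three_colorable_def verts(1) by simp
qed

text \<open>The list of fans must begin at the start of a fan, so the cyclic order has to be cut at a suitable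
  place.\<close>

lemma ring_order_rotate:
  assumes "ring_order G ts"
  shows "ring_order G (rotate k ts)"
proof -
  have "ring_order G (rotate1 ts)" if "ring_order G ts" for ts
  proof -
    let ?n = "length ts"
    have "\<exists>e\<in>cross_edges G. e \<in> face_edges G (rotate1 ts ! i) \<and> e \<in> face_edges G (rotate1 ts ! (Suc i mod ?n))"
      if i: "i < ?n" for i
    proof -
      have n: "Suc i mod ?n < ?n" using i by (intro mod_less_divisor) linarith
      have "rotate1 ts ! i = ts ! (Suc i mod ?n)"
        "rotate1 ts ! (Suc i mod ?n) = ts ! (Suc (Suc i mod ?n) mod ?n)"
        using nth_rotate1 i n by blast+
      then show ?thesis using \<open>ring_order G ts\<close> n unfolding ring_order_def by metis
    qed
    then show ?thesis using that unfolding ring_order_def by simp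
  qed
  then show ?thesis using assms by (induction k) (auto simp: rotate_def)
qed

text \<open>The apex lies in \<open>B\<close> for some triangles and in \<open>A\<close> for others, so it changes somewhere around the
  ring. Cutting the cyclic order there keeps the first and the last run apart.\<close>

lemma fans_exist: "\<exists>fs. fans G fs"
proof -
  obtain ts where ts: "ring_order G ts"
    using cyclic_order_exists ring_order_iff by metis
  interpret swap: tri_ring B A EB EA "triangles G" V by (rule swap_sides)
  have ab: "hd (inner_cycle G) \<in> A" "hd (outer_cycle G) \<in> B"
    using cycles(2,5) by (auto intro!: hd_in_set)
  obtain t where t: "t \<in> triangles G" "on_A t" using ex_A_triangle_at[OF ab(1)] .
  obtain u where u: "u \<in> triangles G" "\<not> on_A u" using swap.ex_A_triangle_at[OF ab(2)] on_A_swap by metis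
  have tu: "apex G t \<noteq> apex G u" using apex_on_A[OF t] apex_not_on_A[OF u] verts(2) by blast
  have in_ts: "t \<in> set ts" "u \<in> set ts" using t u ts by (auto simp: ring_order_def)
  have "\<exists>i. Suc i < length ts \<and> apex G (ts ! i) \<noteq> apex G (ts ! Suc i)"
  proof (rule ccontr)
    assume "\<not> ?thesis"
    then have eq: "\<And>i. Suc i < length ts \<Longrightarrow> apex G (ts ! Suc i) = apex G (ts ! i)" by metis
    have "apex G (ts ! i) = apex G (ts ! 0)" if "i < length ts" for i
      using that by (induction i) (auto simp: eq)
    then show False using in_ts tu by (metis in_set_conv_nth)
  qed
  then obtain i where i: "Suc i < length ts" "apex G (ts ! i) \<noteq> apex G (ts ! Suc i)" by blast
  define ts' where "ts' = rotate (Suc i) ts"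
  have ts': "ring_order G ts'" unfolding ts'_def by (rule ring_order_rotate[OF ts])
  have ts'_ne: "ts' \<noteq> []" using i(1) unfolding ts'_def by auto
  have nth: "ts' ! k = ts ! ((Suc i + k) mod length ts)" if "k < length ts" for k
    unfolding ts'_def using that by (rule nth_rotate)
  have "hd ts' = ts ! Suc i"
  proof -
    have "0 < length ts" using i(1) by linarith
    then show ?thesis using nth[of 0] i(1) ts'_ne by (simp add: hd_conv_nth)
  qed
  moreover have "last ts' = ts ! i"
  proof -
    have "last ts' = ts ! ((Suc i + (length ts - 1)) mod length ts)"
    proof -
      have "length ts' = length ts" "length ts - 1 < length ts" using i(1) by (simp_all add: ts'_def)
      then show ?thesis using nth[of "length ts - 1"] last_conv_nth[OF ts'_ne] by simp
    qed
    moreover have "Suc i + (length ts - 1) = i + length ts" using i(1) by simp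
    ultimately show ?thesis using i(1) by simp
  qed
  ultimately have ends: "apex G (last ts') \<noteq> apex G (hd ts')" using i(2) by simp
  obtain fs where fs: "concat fs = ts'" "\<forall>f\<in>set fs. f \<noteq> [] \<and> (\<forall>t\<in>set f. apex G t = apex G (hd f))"
    "\<forall>j. Suc j < length fs \<longrightarrow> apex G (hd (fs ! j)) \<noteq> apex G (hd (fs ! Suc j))"
    using split_into_runs[OF ts'_ne, of "apex G"] by blast
  have fs_ne: "fs \<noteq> []" using fs(1) ts'_ne by auto
  have "apex G (hd (fs ! j)) \<noteq> apex G (hd (fs ! (Suc j mod length fs)))" if j: "j < length fs" for j
  proof (cases "Suc j < length fs")
    case True
    then show ?thesis using fs(3) by simp
  next
    case False
    then have eq: "Suc j = length fs" using j by simp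
    then have last: "fs ! j = last fs" using fs_ne by (simp add: last_conv_nth flip: eq)
    have "hd (fs ! 0) = hd ts'"
      using fs(1,2) fs_ne by (cases fs) auto
    moreover have "last (last fs) = last ts'"
    proof -
      have "ts' = concat (butlast fs) @ last fs"
        using fs(1) append_butlast_last_id[OF fs_ne] by (metis concat_append concat.simps append_Nil2)
      then show ?thesis using fs(2) fs_ne by (simp add: last_append)
    qed
    moreover have "apex G (last (last fs)) = apex G (hd (last fs))"
      using fs(2) fs_ne by (metis last_in_set)
    ultimately show ?thesis using eq last ends by simp
  qed
  then have "\<forall>j<length fs. apex G (hd (fs ! j)) \<noteq> apex G (hd (fs ! (Suc j mod length fs)))" by blast
  then have "fans G fs" unfolding fans_def fs(1) using ts' fs(2) by (intro conjI)
  then show ?thesis by blast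
qed

lemma three_colorable_iff_fan_parities_in_T:
  assumes "fans G fs"
  shows "three_colorable G \<longleftrightarrow> map (\<lambda>f. of_nat (length f)) fs \<in> T"
  unfolding three_colorable_iff
proof (rule proper_coloring_iff_fan_parities_in_T[OF apex_on_A apex_not_on_A])
  have order: "ring_order G (concat fs)" using assms by (simp add: fans_def)
  show "distinct (concat fs)" "set (concat fs) = triangles G"
    using order by (simp_all add: ring_order_def)
  show "\<exists>a\<in>A. \<exists>b\<in>B. {a, b} \<subseteq> V (concat fs ! i) \<and> {a, b} \<subseteq> V (concat fs ! (Suc i mod length (concat fs)))"
    if "i < length (concat fs)" for i
    using order that unfolding ring_order_iff by blast
  show "\<forall>f\<in>set fs. f \<noteq> [] \<and> (\<forall>t\<in>set f. apex G t = apex G (hd f))"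
    using assms unfolding fans_def by (elim conjE)
  show "\<forall>j<length fs. apex G (hd (fs ! j)) \<noteq> apex G (hd (fs ! (Suc j mod length fs)))"
    using assms unfolding fans_def by (elim conjE)
qed

end

theorem lemma2:
  fixes G :: ring_graph
  assumes "triangulated_ring G"
  shows "three_colorable G \<longleftrightarrow> cps G \<in> T"
proof -
  interpret triangulated_ring_graph G using assms by unfold_locales
  have "\<exists>p. \<exists>fs. fans G fs \<and> p = map (\<lambda>f. of_nat (length f)) fs" using fans_exist by blast
  then have "\<exists>fs. fans G fs \<and> cps G = map (\<lambda>f. of_nat (length f)) fs"
    unfolding cps_def by (rule someI_ex)
  then show ?thesis using three_colorable_iff_fan_parities_in_T by auto
qed

end
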